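(* Let $A=(a_{ij})_{i,j\in I}$ be a generalized Cartan matrix such that $\Gamma(A)$ is a conical tree with the root $0$, let $J_+$ be a set of leaves of $\Gamma(A)$ attached to $0$ (i.e. $i^+=0$ for all $i\in J_+$), and suppose that $a_{ij}\in\{0,-1\}$ for all distinct $i,j\in I\setminus J_+$ with $j\ne0$ and that $a_{i0}=-1$ for all $i\in J_+$. Let $\mathfrak g=\mathfrak g_A$, $\mathbf a=(a_i)_{i\in I}\in\mathbb C^I$, $u_i=e_i+a_i[e_i,f_i]-a_i^2f_i$. Put $$\mathbf f_+:=\sum_{j\in J_+}a_jf_j,\qquad \mathbf f:=\sum_{j\in I\setminus J_+:\,j^+=0}a_jf_j,\qquad f_0':=\sum_{k\ge0}\frac1{k!}(\mathrm{ad}\,\mathbf f_+)^k(f_0),$$ $$f_i':=\sum_{k\ge0}\frac1{k!}(\mathrm{ad}(\mathbf f_+-a_if_i))^k(f_0)\quad(i\in J_+),\qquad g_{\mathbf a}=e^{\mathbf f_+}e^{a_0f_0}\prod_{i\in I\setminus(\{0\}\cup J_+)}e^{a_if_i},$$ where the product is decreasing (i.e. $i^+$ always precedes $i$). Let $b_i:=-a_0a_i$ for $i\in J_+$. Then: for $i\in J_+$, $$(\mathrm{Ad}\,g_{\mathbf a})(u_i)=e_i+b_if_i'-\frac{b_i^2}{2}[[f_i,f_i'],f_i']-a_i^2\sum_{k\ge3}\frac{a_0^k}{k!}\big(\mathrm{ad}(f_i'+a_i[f_i,f_i'])\big)^{k-2}\big([[f_i,f_i'],f_i']\big);$$ for $i=0$,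 $$(\mathrm{Ad}\,g_{\mathbf a})(u_0)=e_0-a_0\mathbf f-\frac{a_0^2}{2}[\mathbf f,[\mathbf f,f_0']]-a_0^2\sum_{k\ge3}\frac1{k!}\big(\mathrm{ad}(\mathbf f+a_0[f_0',\mathbf f])\big)^{k-2}\big([\mathbf f,[\mathbf f,f_0']]\big);$$ and for all other $i$, $(\mathrm{Ad}\,g_{\mathbf a})(u_i)=e_i+b_{i^-}f_{i^-}$, where $b_{i^-}:=-a_{i^-}a_i$ (the term $b_{i^-}f_{i^-}$ being $0$ if $i$ is a leaf).
   Context: A generalized Cartan matrix has $a_{ii}=2$, $a_{ij}\in\mathbb Z_{\le0}$ for $i\ne j$, $a_{ij}=0$ iff $a_{ji}=0$. $\mathfrak g_A$ is the complex Lie algebra generated by $e_i,f_i$, $h_i:=[e_i,f_i]$, subject to $[h_i,h_j]=0$, $[e_i,f_j]=\delta_{ij}h_i$, $[h_i,e_j]=a_{ij}e_j$, $[h_i,f_j]=-a_{ij}f_j$, and the Serre relations $(\mathrm{ad}\,e_i)^{1-a_{ij}}(e_j)=(\mathrm{ad}\,f_i)^{1-a_{ij}}(f_j)=0$. $\Gamma(A)$ is the graph on vertex set $I$ in which $\{i,j\}$, $i\neq j$, is an edge iff $a_{ij}<0$. A rooted tree (root denoted $0$) is conical if the only possible branching is at the root. For $i\ne0$, $i^+$ is the parent of $i$; for a non-leaf $i\neq0$, $i^-$ is the unique child of $i$. $\mathrm{Ad}\,e^{x}$ means $e^{\mathrm{ad}\,x}$ (for locally ad-nilpotent $x$), and $\mathrm{Ad}$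 of a product is the composition. Double-index $a_{ij}$ are Cartan entries; single-index $a_i$ are parameters. *)

theory Defs
  imports Complex_Main "HOL-Algebra.Module" "HOL-Algebra.Algebraic_Closure_Type"
begin

section \<open>Complex Lie algebras\<close>

record 'a lie_algebra = "(complex, 'a) module" +
  lie_bracket :: "'a \<Rightarrow> 'a \<Rightarrow> 'a" (\<open>\<lbrakk>_,/ _\<rbrakk>\<index>\<close>)

text \<open>The ring fields \<^term>\<open>monoid.mult\<close> and \<^term>\<open>monoid.one\<close> of the underlying module record
  play no role, as usual for modules in the algebra library.\<close>

locale complex_lie_algebra = module "ring_of_type_algebra :: complex ring" L
  for L :: "('a, 'm) lie_algebra_scheme" (structure) +
  assumes bracket_closed:
      "\<lbrakk>x \<in> carrier L; y \<in> carrier L\<rbrakk> \<Longrightarrow> \<lbrakk>x, y\<rbrakk> \<in> carrier L"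
    and bracket_add_left:
      "\<lbrakk>x \<in> carrier L; y \<in> carrier L; z \<in> carrier L\<rbrakk> \<Longrightarrow> \<lbrakk>x \<oplus> y, z\<rbrakk> = \<lbrakk>x, z\<rbrakk> \<oplus> \<lbrakk>y, z\<rbrakk>"
    and bracket_add_right:
      "\<lbrakk>x \<in> carrier L; y \<in> carrier L; z \<in> carrier L\<rbrakk> \<Longrightarrow> \<lbrakk>x, y \<oplus> z\<rbrakk> = \<lbrakk>x, y\<rbrakk> \<oplus> \<lbrakk>x, z\<rbrakk>"
    and bracket_smult_left:
      "\<lbrakk>x \<in> carrier L; y \<in> carrier L\<rbrakk> \<Longrightarrow> \<lbrakk>c \<odot> x, y\<rbrakk> = c \<odot> \<lbrakk>x, y\<rbrakk>"
    and bracket_smult_right: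
      "\<lbrakk>x \<in> carrier L; y \<in> carrier L\<rbrakk> \<Longrightarrow> \<lbrakk>x, c \<odot> y\<rbrakk> = c \<odot> \<lbrakk>x, y\<rbrakk>"
    and bracket_self: "x \<in> carrier L \<Longrightarrow> \<lbrakk>x, x\<rbrakk> = \<zero>"
    and jacobi:
      "\<lbrakk>x \<in> carrier L; y \<in> carrier L; z \<in> carrier L\<rbrakk> \<Longrightarrow>
        \<lbrakk>x, \<lbrakk>y, z\<rbrakk>\<rbrakk> \<oplus> \<lbrakk>y, \<lbrakk>z, x\<rbrakk>\<rbrakk> \<oplus> \<lbrakk>z, \<lbrakk>x, y\<rbrakk>\<rbrakk> = \<zero>"

text \<open>Infinite sums are understood algebraically: only finitely many summands are nonzero.
  (A sum with infinitely many nonzero summands gets the value \<^term>\<open>\<zero>\<^bsub>L\<^esub>\<close>.)\<close>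

definition lie_sum :: "('a, 'm) lie_algebra_scheme \<Rightarrow> nat set \<Rightarrow> (nat \<Rightarrow> 'a) \<Rightarrow> 'a" where
  "lie_sum L K s = (\<Oplus>\<^bsub>L\<^esub> k \<in> {k \<in> K. s k \<noteq> \<zero>\<^bsub>L\<^esub>}. s k)"

definition locally_ad_nilpotent :: "('a, 'm) lie_algebra_scheme \<Rightarrow> 'a \<Rightarrow> bool" where
  "locally_ad_nilpotent L x \<longleftrightarrow>
     x \<in> carrier L \<and> (\<forall>y \<in> carrier L. \<exists>n. (lie_bracket L x ^^ n) y = \<zero>\<^bsub>L\<^esub>)"

definition Ad_exp :: "('a, 'm) lie_algebra_scheme \<Rightarrow> 'a \<Rightarrow> 'a \<Rightarrow> 'a" where
  "Ad_exp L x y = lie_sum L UNIV (\<lambda>k. (1 / fact k) \<odot>\<^bsub>L\<^esub> (lie_bracket L x ^^ k) y)"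

text \<open>The list \<open>[x\<^sub>1, \<dots>, x\<^sub>n]\<close> stands for the product \<open>exp x\<^sub>1 \<dots> exp x\<^sub>n\<close>, so its last entry acts first.\<close>

definition Ad_prod :: "('a, 'm) lie_algebra_scheme \<Rightarrow> 'a list \<Rightarrow> 'a \<Rightarrow> 'a" where
  "Ad_prod L xs = foldr (Ad_exp L) xs"


section \<open>Lie algebras given by generators and relations\<close>

datatype 'x lie_term =
    Gen 'x
  | Zero
  | Add "'x lie_term" "'x lie_term"
  | Scale complex "'x lie_term"
  | Brk "'x lie_term" "'x lie_term"

text \<open>\<open>lie_cong R\<close> is the least congruence on terms that contains the pairs in \<open>R\<close> and validates
  the axioms of a complex Lie algebra. Thus for \<open>R = {}\<close> the quotient is the free Lie algebra, and
  in general it is the free Lie algebra modulo the ideal generated by the \<open>s - t\<close> for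
  \<open>(s, t) \<in> R\<close>.\<close>

inductive lie_cong :: "('x lie_term \<times> 'x lie_term) set \<Rightarrow> 'x lie_term \<Rightarrow> 'x lie_term \<Rightarrow> bool"
  for R where
  rel: "(s, t) \<in> R \<Longrightarrow> lie_cong R s t"
| refl: "lie_cong R s s"
| sym: "lie_cong R s t \<Longrightarrow> lie_cong R t s"
| trans: "lie_cong R s t \<Longrightarrow> lie_cong R t u \<Longrightarrow> lie_cong R s u"
| Add_cong: "lie_cong R s s' \<Longrightarrow> lie_cong R t t' \<Longrightarrow> lie_cong R (Add s t) (Add s' t')"
| Scale_cong: "lie_cong R s s' \<Longrightarrow> lie_cong R (Scale c s) (Scale c s')"
| Brk_cong: "lie_cong R s s' \<Longrightarrow> lie_cong R t t' \<Longrightarrow> lie_cong R (Brk s t) (Brk s' t')"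
| Add_assoc: "lie_cong R (Add (Add s t) u) (Add s (Add t u))"
| Add_comm: "lie_cong R (Add s t) (Add t s)"
| Add_Zero: "lie_cong R (Add Zero s) s"
| Add_inv: "lie_cong R (Add (Scale (-1) s) s) Zero"
| Scale_add_left: "lie_cong R (Scale (c + d) s) (Add (Scale c s) (Scale d s))"
| Scale_add_right: "lie_cong R (Scale c (Add s t)) (Add (Scale c s) (Scale c t))"
| Scale_Scale: "lie_cong R (Scale (c * d) s) (Scale c (Scale d s))"
| Scale_one: "lie_cong R (Scale 1 s) s"
| Brk_add_left: "lie_cong R (Brk (Add s t) u) (Add (Brk s u) (Brk t u))"
| Brk_add_right: "lie_cong R (Brk s (Add t u)) (Add (Brk s t) (Brk s u))"
| Brk_scale_left: "lie_cong R (Brk (Scale c s) t) (Scale c (Brk s t))"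
| Brk_scale_right: "lie_cong R (Brk s (Scale c t)) (Scale c (Brk s t))"
| Brk_self: "lie_cong R (Brk s s) Zero"
| Jacobi: "lie_cong R (Add (Add (Brk s (Brk t u)) (Brk t (Brk u s))) (Brk u (Brk s t))) Zero"

definition lie_class :: "('x lie_term \<times> 'x lie_term) set \<Rightarrow> 'x lie_term \<Rightarrow> 'x lie_term set" where
  "lie_class R s = {t. lie_cong R s t}"

definition presented_lie_algebra ::
    "('x lie_term \<times> 'x lie_term) set \<Rightarrow> 'x lie_term set lie_algebra" where
  "presented_lie_algebra R =
     \<lparr>carrier = range (lie_class R),
      monoid.mult = (\<lambda>_ _. undefined), one = undefined,
      ring.zero = lie_class R Zero,
      add = (\<lambda>S T. \<Union>s\<in>S. \<Union>t\<in>T. lie_class R (Add s t)),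
      module.smult = (\<lambda>c S. \<Union>s\<in>S. lie_class R (Scale c s)),
      lie_bracket = (\<lambda>S T. \<Union>s\<in>S. \<Union>t\<in>T. lie_class R (Brk s t))\<rparr>"

lemma lie_class_eq_iff: "lie_class R s = lie_class R t \<longleftrightarrow> lie_cong R s t"
  unfolding lie_class_def by (auto intro: lie_cong.intros)

lemma presented_lie_algebra_simps:
  "carrier (presented_lie_algebra R) = range (lie_class R)"
  "\<zero>\<^bsub>presented_lie_algebra R\<^esub> = lie_class R Zero"
  "lie_class R s \<oplus>\<^bsub>presented_lie_algebra R\<^esub> lie_class R t = lie_class R (Add s t)"
  "c \<odot>\<^bsub>presented_lie_algebra R\<^esub> lie_class R s = lie_class R (Scale c s)"
  "\<lbrakk>lie_class R s, lie_class R t\<rbrakk>\<^bsub>presented_lie_algebra R\<^esub> = lie_class R (Brk s t)"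
  unfolding presented_lie_algebra_def
  by (auto simp: lie_class_def intro: lie_cong.intros)

lemma complex_lie_algebra_presented: "complex_lie_algebra (presented_lie_algebra R)"
proof -
  let ?L = "presented_lie_algebra R"
  have ag: "abelian_group ?L"
  proof (rule abelian_groupI)
    fix x assume "x \<in> carrier ?L"
    then obtain s where "x = lie_class R s"
      by (auto simp: presented_lie_algebra_simps)
    then show "\<exists>y\<in>carrier ?L. y \<oplus>\<^bsub>?L\<^esub> x = \<zero>\<^bsub>?L\<^esub>"
      by (intro bexI[of _ "lie_class R (Scale (-1) s)"])
        (auto simp: presented_lie_algebra_simps lie_class_eq_iff del: equalityI
          intro: rangeI lie_cong.Add_inv)
  qed (auto simp: presented_lie_algebra_simps lie_class_eq_iff
      del: equalityI
      intro: rangeI lie_cong.Add_assoc lie_cong.Add_comm lie_cong.Add_Zero)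
  have "module (ring_of_type_algebra :: complex ring) ?L"
    by (rule moduleI[OF cring_from_type_algebra ag])
      (auto simp: ring_of_type_algebra_def presented_lie_algebra_simps lie_class_eq_iff
        del: equalityI
        intro: rangeI lie_cong.Scale_add_left lie_cong.Scale_add_right lie_cong.Scale_Scale
          lie_cong.Scale_one)
  then show ?thesis
    by (intro complex_lie_algebra.intro complex_lie_algebra_axioms.intro)
      (auto simp: presented_lie_algebra_simps lie_class_eq_iff
        del: equalityI
        intro: rangeI lie_cong.Brk_add_left lie_cong.Brk_add_right lie_cong.Brk_scale_left
          lie_cong.Brk_scale_right lie_cong.Brk_self lie_cong.Jacobi)
qed


section \<open>The Lie algebra of a generalized Cartan matrix\<close>

definition generalized_cartan_matrix :: "('i \<Rightarrow> 'i \<Rightarrow> int) \<Rightarrow> bool" where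
  "generalized_cartan_matrix A \<longleftrightarrow>
     (\<forall>i. A i i = 2) \<and>
     (\<forall>i j. i \<noteq> j \<longrightarrow> A i j \<le> 0) \<and>
     (\<forall>i j. A i j = 0 \<longleftrightarrow> A j i = 0)"

datatype 'i chevalley = E 'i | F 'i

abbreviation H_term :: "'i \<Rightarrow> 'i chevalley lie_term" where
  "H_term i \<equiv> Brk (Gen (E i)) (Gen (F i))"

definition cartan_relations ::
    "('i \<Rightarrow> 'i \<Rightarrow> int) \<Rightarrow> ('i chevalley lie_term \<times> 'i chevalley lie_term) set" where
  "cartan_relations A =
     {(Brk (H_term i) (H_term j), Zero) | i j. True} \<union>
     {(Brk (Gen (E i)) (Gen (F j)), if i = j then H_term i else Zero) | i j. True} \<union>
     {(Brk (H_term i) (Gen (E j)), Scale (of_int (A i j)) (Gen (E j))) | i j. True} \<union>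
     {(Brk (H_term i) (Gen (F j)), Scale (- of_int (A i j)) (Gen (F j))) | i j. True} \<union>
     {((Brk (Gen (E i)) ^^ nat (1 - A i j)) (Gen (E j)), Zero) | i j. i \<noteq> j} \<union>
     {((Brk (Gen (F i)) ^^ nat (1 - A i j)) (Gen (F j)), Zero) | i j. i \<noteq> j}"

definition cartan_lie_algebra ::
    "('i \<Rightarrow> 'i \<Rightarrow> int) \<Rightarrow> 'i chevalley lie_term set lie_algebra" where
  "cartan_lie_algebra A = presented_lie_algebra (cartan_relations A)"

definition chevalley_e :: "('i \<Rightarrow> 'i \<Rightarrow> int) \<Rightarrow> 'i \<Rightarrow> 'i chevalley lie_term set" where
  "chevalley_e A i = lie_class (cartan_relations A) (Gen (E i))"

definition chevalley_f :: "('i \<Rightarrow> 'i \<Rightarrow> int) \<Rightarrow> 'i \<Rightarrow> 'i chevalley lie_term set" where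
  "chevalley_f A i = lie_class (cartan_relations A) (Gen (F i))"


section \<open>Rooted trees\<close>

text \<open>A graph on the vertex set \<^term>\<open>UNIV\<close> is given by its adjacency relation. The notion of tree
  in the digraph library does not apply here: every edge of a symmetric digraph is a cycle of
  length two.\<close>

definition cartan_graph :: "('i \<Rightarrow> 'i \<Rightarrow> int) \<Rightarrow> 'i \<Rightarrow> 'i \<Rightarrow> bool" where
  "cartan_graph A i j \<longleftrightarrow> i \<noteq> j \<and> A i j < 0"

definition simple_path :: "('v \<Rightarrow> 'v \<Rightarrow> bool) \<Rightarrow> 'v list \<Rightarrow> bool" where
  "simple_path G p \<longleftrightarrow> p \<noteq> [] \<and> distinct p \<and> successively G p"

definition tree_graph :: "('v \<Rightarrow> 'v \<Rightarrow> bool) \<Rightarrow> bool" where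
  "tree_graph G \<longleftrightarrow>
     (\<forall>u v. \<exists>p. simple_path G p \<and> hd p = u \<and> last p = v) \<and>
     \<not> (\<exists>p. simple_path G p \<and> 3 \<le> length p \<and> G (last p) (hd p))"

text \<open>The parent of \<open>v\<close> is the last vertex before \<open>v\<close> on the path from the root \<open>r\<close> to \<open>v\<close>.\<close>

definition parent_of :: "('v \<Rightarrow> 'v \<Rightarrow> bool) \<Rightarrow> 'v \<Rightarrow> 'v \<Rightarrow> 'v \<Rightarrow> bool" where
  "parent_of G r u v \<longleftrightarrow> (\<exists>p. simple_path G (p @ [u, v]) \<and> hd (p @ [u, v]) = r)"

definition children :: "('v \<Rightarrow> 'v \<Rightarrow> bool) \<Rightarrow> 'v \<Rightarrow> 'v \<Rightarrow> 'v set" where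
  "children G r u = {v. parent_of G r u v}"

text \<open>Leaves are leaves of the rooted tree; in particular the root is a leaf only if it is the
  only vertex.\<close>

definition leaf :: "('v \<Rightarrow> 'v \<Rightarrow> bool) \<Rightarrow> 'v \<Rightarrow> 'v \<Rightarrow> bool" where
  "leaf G r v \<longleftrightarrow> children G r v = {}"

definition conical_tree :: "('v \<Rightarrow> 'v \<Rightarrow> bool) \<Rightarrow> 'v \<Rightarrow> bool" where
  "conical_tree G r \<longleftrightarrow>
     tree_graph G \<and> (\<forall>u v w. u \<noteq> r \<longrightarrow> v \<in> children G r u \<longrightarrow> w \<in> children G r u \<longrightarrow> v = w)"

end

theory Submission
  imports Defs
begin

text \<open>Everything rests on the fact that \<open>\<phi> (Ad (exp x) y) = Ad (exp (\<phi> x)) (\<phi> y)\<close> for an automorphism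
  \<open>\<phi>\<close>, together with \<open>Ad (exp (a\<^sub>i f\<^sub>i)) u\<^sub>i = e\<^sub>i\<close>. Since only tree neighbours fail to commute, moving
  \<open>Ad (exp (a\<^sub>i f\<^sub>i))\<close> past the factors that act before it turns the image of \<open>u\<^sub>i\<close> into a single
  \<open>Ad (exp x) e\<^sub>i\<close>: with \<open>x = f + a\<^sub>0 [f\<^sub>0', f]\<close> for the root, \<open>x = a\<^sub>0 (f\<^sub>i' + a\<^sub>i [f\<^sub>i, f\<^sub>i'])\<close> for \<open>i\<close> in \<open>J\<close>, and
  \<open>x = a\<^sub>j (f\<^sub>j + a\<^sub>i [f\<^sub>i, f\<^sub>j])\<close> for any other \<open>i\<close> with child \<open>j\<close>. The stated formulas are the expansions of
  these exponentials, because \<open>[x, e\<^sub>i]\<close> is \<open>- a\<^sub>0 f\<close>, \<open>- a\<^sub>0 a\<^sub>i f\<^sub>i'\<close> and \<open>- a\<^sub>j a\<^sub>i f\<^sub>j\<close>, respectively.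
  Local nilpotency holds because these \<open>x\<close> are conjugate to \<open>f\<close>, \<open>a\<^sub>0 f\<^sub>0\<close> and \<open>a\<^sub>j f\<^sub>j\<close>.\<close>

section \<open>Exponentials of locally ad-nilpotent elements\<close>

context complex_lie_algebra
begin

section \<open>Scalars, brackets and finite sums\<close>

lemma scalar_carrier [simp]: "(c::complex) \<in> carrier ring_of_type_algebra"
  by (simp add: ring_of_type_algebra_def)

lemma scalar_closed [simp, intro]: "x \<in> carrier L \<Longrightarrow> c \<odot> x \<in> carrier L"
  by (rule smult_closed) auto

lemma scalar_add_left: "x \<in> carrier L \<Longrightarrow> (c + d) \<odot> x = c \<odot> x \<oplus> d \<odot> x"
  using smult_l_distr[of c d x] by (simp add: ring_of_type_algebra_def)

lemma scalar_add_right: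
  "\<lbrakk>x \<in> carrier L; y \<in> carrier L\<rbrakk> \<Longrightarrow> c \<odot> (x \<oplus> y) = c \<odot> x \<oplus> c \<odot> y"
  by (rule smult_r_distr) auto

lemma scalar_scalar [simp]: "x \<in> carrier L \<Longrightarrow> c \<odot> (d \<odot> x) = (c * d) \<odot> x"
  using smult_assoc1[of c d x] by (simp add: ring_of_type_algebra_def)

lemma scalar_one [simp]: "x \<in> carrier L \<Longrightarrow> 1 \<odot> x = x"
  using smult_one[of x] by (simp add: ring_of_type_algebra_def)

lemma scalar_zero_left [simp]: "x \<in> carrier L \<Longrightarrow> 0 \<odot> x = \<zero>"
  using smult_l_null[of x] by (simp add: ring_of_type_algebra_def)

lemma scalar_zero_right [simp]: "c \<odot> \<zero> = \<zero>"
  by (rule smult_r_null) simp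

lemma neg_eq_scalar:
  assumes "x \<in> carrier L" shows "\<ominus> x = (-1) \<odot> x"
proof -
  have "(-1) \<odot> x \<oplus> x = \<zero>"
    using scalar_add_left[OF assms, of "-1" 1] assms by simp
  then show ?thesis using assms by (simp add: M.minus_equality)
qed

lemma minus_eq_scalar:
  "x \<in> carrier L \<Longrightarrow> y \<in> carrier L \<Longrightarrow> x \<ominus> y = x \<oplus> (-1) \<odot> y"
  by (simp add: a_minus_def neg_eq_scalar)

declare bracket_closed [simp, intro]
declare bracket_self [simp]

lemma bracket_zero_left [simp]: "x \<in> carrier L \<Longrightarrow> \<lbrakk>\<zero>, x\<rbrakk> = \<zero>"
  using bracket_smult_left[of \<zero> x 0] by simp

lemma bracket_zero_right [simp]: "x \<in> carrier L \<Longrightarrow> \<lbrakk>x, \<zero>\<rbrakk> = \<zero>"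
  using bracket_smult_right[of x \<zero> 0] by simp

lemma bracket_swap:
  assumes x: "x \<in> carrier L" and y: "y \<in> carrier L"
  shows "\<lbrakk>x, y\<rbrakk> = (-1) \<odot> \<lbrakk>y, x\<rbrakk>"
proof -
  have "\<lbrakk>x, y\<rbrakk> \<oplus> \<lbrakk>y, x\<rbrakk> = \<zero>"
    using bracket_self[of "x \<oplus> y"] x y
    by (simp add: bracket_add_left bracket_add_right M.a_comm del: bracket_self)
      (simp add: M.a_comm)
  then show ?thesis
    using x y by (simp add: M.minus_equality flip: neg_eq_scalar)
qed

lemma bracket_zero_swap:
  "\<lbrakk>x \<in> carrier L; y \<in> carrier L; \<lbrakk>x, y\<rbrakk> = \<zero>\<rbrakk> \<Longrightarrow> \<lbrakk>y, x\<rbrakk> = \<zero>"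
  using bracket_swap[of y x] by simp

text \<open>Jacobi with antisymmetry applied twice: \<open>ad x\<close> acts as a derivation. This
  is the form in which the Jacobi identity is used from here on.\<close>

lemma bracket_derivation:
  assumes "x \<in> carrier L" "y \<in> carrier L" "z \<in> carrier L"
  shows "\<lbrakk>x, \<lbrakk>y, z\<rbrakk>\<rbrakk> = \<lbrakk>\<lbrakk>x, y\<rbrakk>, z\<rbrakk> \<oplus> \<lbrakk>y, \<lbrakk>x, z\<rbrakk>\<rbrakk>"
proof -
  have 1: "\<lbrakk>y, \<lbrakk>z, x\<rbrakk>\<rbrakk> = (-1) \<odot> \<lbrakk>y, \<lbrakk>x, z\<rbrakk>\<rbrakk>"
    using assms bracket_swap[of z x] by (simp add: bracket_smult_right)
  have 2: "\<lbrakk>z, \<lbrakk>x, y\<rbrakk>\<rbrakk> = (-1) \<odot> \<lbrakk>\<lbrakk>x, y\<rbrakk>, z\<rbrakk>"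
    using assms bracket_swap[of z "\<lbrakk>x, y\<rbrakk>"] by simp
  have "\<lbrakk>x, \<lbrakk>y, z\<rbrakk>\<rbrakk> \<oplus> ((-1) \<odot> \<lbrakk>y, \<lbrakk>x, z\<rbrakk>\<rbrakk> \<oplus> (-1) \<odot> \<lbrakk>\<lbrakk>x, y\<rbrakk>, z\<rbrakk>) = \<zero>"
    using jacobi[OF assms, unfolded 1 2] assms by (simp only: M.a_assoc scalar_closed bracket_closed)
  then have "\<lbrakk>x, \<lbrakk>y, z\<rbrakk>\<rbrakk> = (-1) \<odot> ((-1) \<odot> \<lbrakk>y, \<lbrakk>x, z\<rbrakk>\<rbrakk> \<oplus> (-1) \<odot> \<lbrakk>\<lbrakk>x, y\<rbrakk>, z\<rbrakk>)"
    using assms by (simp add: M.minus_equality flip: neg_eq_scalar)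
  also have "\<dots> = \<lbrakk>y, \<lbrakk>x, z\<rbrakk>\<rbrakk> \<oplus> \<lbrakk>\<lbrakk>x, y\<rbrakk>, z\<rbrakk>"
    using assms by (simp add: scalar_add_right)
  finally show ?thesis using assms by (simp add: M.a_comm)
qed

lemma bracket_finsum_right:
  assumes "x \<in> carrier L" "\<And>i. i \<in> S \<Longrightarrow> s i \<in> carrier L"
  shows "\<lbrakk>x, (\<Oplus>i\<in>S. s i)\<rbrakk> = (\<Oplus>i\<in>S. \<lbrakk>x, s i\<rbrakk>)"
  using assms
proof (induction S rule: infinite_finite_induct)
  case (insert i S)
  then show ?case
    by (subst (1 2) M.finsum_insert) (auto simp: bracket_add_right)
\<comment> \<open>For infinite \<open>S\<close> both sums are zero by default, as they are for
  \<open>S = {}\<close>.\<close>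
qed auto

lemma bracket_finsum_left:
  assumes "x \<in> carrier L" "\<And>i. i \<in> S \<Longrightarrow> s i \<in> carrier L"
  shows "\<lbrakk>(\<Oplus>i\<in>S. s i), x\<rbrakk> = (\<Oplus>i\<in>S. \<lbrakk>s i, x\<rbrakk>)"
  using assms
proof (induction S rule: infinite_finite_induct)
  case (insert i S)
  then show ?case
    by (subst (1 2) M.finsum_insert) (auto simp: bracket_add_left)
qed auto

lemma scalar_finsum:
  assumes "\<And>i. i \<in> S \<Longrightarrow> s i \<in> carrier L"
  shows "c \<odot> (\<Oplus>i\<in>S. s i) = (\<Oplus>i\<in>S. c \<odot> s i)"
  using assms
proof (induction S rule: infinite_finite_induct)
  case (insert i S)
  then show ?case
    by (subst (1 2) M.finsum_insert) (auto simp: scalar_add_right)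
qed auto

lemma finsum_lessThan_Suc:
  assumes "\<And>i::nat. s i \<in> carrier L"
  shows "(\<Oplus>i\<in>{..<Suc n}. s i) = (\<Oplus>i\<in>{..<n}. s i) \<oplus> s n"
  using assms by (simp add: lessThan_Suc M.finsum_insert Pi_def M.a_comm)

lemma finsum_zero_extend:
  assumes "m \<le> n" "\<And>i::nat. s i \<in> carrier L" "\<And>i. m \<le> i \<Longrightarrow> s i = \<zero>"
  shows "(\<Oplus>i\<in>{..<n}. s i) = (\<Oplus>i\<in>{..<m}. s i)"
  by (rule M.add.finprod_mono_neutral_cong_right) (use assms in auto)

text \<open>The support lies below \<open>N\<close>, so the sum over it may be padded with zeros to
  an interval. Any vanishing bound will do, which lets several series share one
  \<open>N\<close>.\<close>

lemma lie_sum_eq_finsum: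
  assumes "\<And>k. s k \<in> carrier L" "\<And>k. k \<ge> N \<Longrightarrow> s k = \<zero>"
  shows "lie_sum L UNIV s = (\<Oplus>k\<in>{..<N}. s k)"
  unfolding lie_sum_def
  by (rule M.add.finprod_mono_neutral_cong_left) (use assms in \<open>auto simp: not_le [symmetric]\<close>)

lemma lie_sum_closed:
  assumes "\<And>k. k \<in> K \<Longrightarrow> s k \<in> carrier L"
  shows "lie_sum L K s \<in> carrier L"
  unfolding lie_sum_def by (rule M.finsum_closed) (use assms in auto)

lemma lie_sum_cong:
  assumes "\<And>k. k \<in> K \<Longrightarrow> s k = t k" "\<And>k. k \<in> K \<Longrightarrow> t k \<in> carrier L"
  shows "lie_sum L K s = lie_sum L K t"
  unfolding lie_sum_def by (rule M.finsum_cong') (use assms in auto)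

section \<open>Powers and divided powers of \<open>ad x\<close>\<close>

lemma ad_pow_closed [simp, intro]:
  "\<lbrakk>x \<in> carrier L; y \<in> carrier L\<rbrakk> \<Longrightarrow> (lie_bracket L x ^^ n) y \<in> carrier L"
  by (induction n) auto

lemma ad_pow_zero [simp]: "x \<in> carrier L \<Longrightarrow> (lie_bracket L x ^^ n) \<zero> = \<zero>"
  by (induction n) auto

lemma ad_pow_add:
  "\<lbrakk>x \<in> carrier L; y \<in> carrier L; z \<in> carrier L\<rbrakk> \<Longrightarrow>
    (lie_bracket L x ^^ n) (y \<oplus> z) = (lie_bracket L x ^^ n) y \<oplus> (lie_bracket L x ^^ n) z"
  by (induction n) (auto simp: bracket_add_right)

lemma ad_pow_scalar:
  "\<lbrakk>x \<in> carrier L; y \<in> carrier L\<rbrakk> \<Longrightarrow>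
    (lie_bracket L x ^^ n) (c \<odot> y) = c \<odot> (lie_bracket L x ^^ n) y"
  by (induction n) (auto simp: bracket_smult_right)

lemma ad_scalar_pow:
  "\<lbrakk>x \<in> carrier L; y \<in> carrier L\<rbrakk> \<Longrightarrow>
    (lie_bracket L (c \<odot> x) ^^ n) y = c ^ n \<odot> (lie_bracket L x ^^ n) y"
  by (induction n) (auto simp: bracket_smult_right bracket_smult_left mult.commute)

lemma ad_pow_zero_mono:
  assumes "x \<in> carrier L" "(lie_bracket L x ^^ m) y = \<zero>" "m \<le> n"
  shows "(lie_bracket L x ^^ n) y = \<zero>"
proof -
  have "(lie_bracket L x ^^ n) y = (lie_bracket L x ^^ (n - m)) ((lie_bracket L x ^^ m) y)"
    using assms(3) by (simp flip: funpow_add [THEN fun_cong, simplified])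
  then show ?thesis using assms by simp
qed

text \<open>Induction on \<open>m + n\<close>: one application of the derivation \<open>ad x\<close>
  turns \<open>[y, z]\<close> into two brackets, in each of which one of the two exponents has
  dropped by one. If an exponent is zero, its argument is already zero.\<close>

lemma ad_pow_bracket_zero:
  assumes "x \<in> carrier L" "y \<in> carrier L" "z \<in> carrier L"
    and "(lie_bracket L x ^^ m) y = \<zero>" "(lie_bracket L x ^^ n) z = \<zero>"
  shows "(lie_bracket L x ^^ (m + n)) \<lbrakk>y, z\<rbrakk> = \<zero>"
  using assms
proof (induction "m + n" arbitrary: m n y z rule: less_induct)
  case less
  show ?case
  proof (cases "m = 0 \<or> n = 0")
    case True
    then show ?thesis using less.prems by auto
  next
    case False
    then obtain p q where pq: "m = Suc p" "n = Suc q" by (metis not0_implies_Suc)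
    have 1: "(lie_bracket L x ^^ (p + n)) \<lbrakk>\<lbrakk>x, y\<rbrakk>, z\<rbrakk> = \<zero>"
      using less.prems pq by (intro less.hyps) (auto simp: funpow_swap1)
    have 2: "(lie_bracket L x ^^ (m + q)) \<lbrakk>y, \<lbrakk>x, z\<rbrakk>\<rbrakk> = \<zero>"
      using less.prems pq by (intro less.hyps) (auto simp: funpow_swap1)
    have "(lie_bracket L x ^^ (m + n)) \<lbrakk>y, z\<rbrakk> = (lie_bracket L x ^^ (p + n)) \<lbrakk>x, \<lbrakk>y, z\<rbrakk>\<rbrakk>"
      using pq by (simp add: funpow_swap1)
    also have "\<dots> = \<zero>"
      using less.prems 1 2 pq by (subst bracket_derivation) (simp_all add: ad_pow_add bracket_add_right)
    finally show ?thesis .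
  qed
qed

lemma ad_pow_add_zero:
  assumes "x \<in> carrier L" "y \<in> carrier L" "z \<in> carrier L"
    and "(lie_bracket L x ^^ m) y = \<zero>" "(lie_bracket L x ^^ n) z = \<zero>"
  shows "(lie_bracket L x ^^ (m + n)) (y \<oplus> z) = \<zero>"
  using assms ad_pow_zero_mono[of x m y "m + n"] ad_pow_zero_mono[of x n z "m + n"]
  by (simp add: ad_pow_add)

lemma nilpotent_closed: "locally_ad_nilpotent L x \<Longrightarrow> x \<in> carrier L"
  by (simp add: locally_ad_nilpotent_def)

lemma nilpotentE:
  assumes "locally_ad_nilpotent L x" "y \<in> carrier L"
  obtains n where "\<And>k. k \<ge> n \<Longrightarrow> (lie_bracket L x ^^ k) y = \<zero>"
  using assms ad_pow_zero_mono unfolding locally_ad_nilpotent_def by metis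

lemma nilpotent_zero: "locally_ad_nilpotent L \<zero>"
  unfolding locally_ad_nilpotent_def by (auto intro!: exI[of _ "Suc 0"])

lemma nilpotent_scalar:
  "locally_ad_nilpotent L x \<Longrightarrow> locally_ad_nilpotent L (c \<odot> x)"
  unfolding locally_ad_nilpotent_def
  by (auto simp: ad_scalar_pow) (metis scalar_zero_right)

text \<open>With the factorial absorbed, the Leibniz rule and the exponential law become
  convolutions without binomial coefficients.\<close>

definition ad_dpow :: "'a \<Rightarrow> nat \<Rightarrow> 'a \<Rightarrow> 'a" where
  "ad_dpow x k y = (1 / fact k) \<odot> (lie_bracket L x ^^ k) y"

lemma ad_dpow_closed [simp, intro]:
  "\<lbrakk>x \<in> carrier L; y \<in> carrier L\<rbrakk> \<Longrightarrow> ad_dpow x k y \<in> carrier L"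
  by (auto simp: ad_dpow_def)

lemma ad_dpow_0 [simp]: "y \<in> carrier L \<Longrightarrow> ad_dpow x 0 y = y"
  by (simp add: ad_dpow_def)

lemma ad_dpow_zero [simp]: "x \<in> carrier L \<Longrightarrow> ad_dpow x k \<zero> = \<zero>"
  by (simp add: ad_dpow_def)

lemma ad_dpow_add:
  "\<lbrakk>x \<in> carrier L; y \<in> carrier L; z \<in> carrier L\<rbrakk> \<Longrightarrow>
    ad_dpow x k (y \<oplus> z) = ad_dpow x k y \<oplus> ad_dpow x k z"
  by (simp add: ad_dpow_def ad_pow_add scalar_add_right)

lemma ad_dpow_scalar:
  "\<lbrakk>x \<in> carrier L; y \<in> carrier L\<rbrakk> \<Longrightarrow> ad_dpow x k (c \<odot> y) = c \<odot> ad_dpow x k y"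
  by (simp add: ad_dpow_def ad_pow_scalar mult.commute)

lemma ad_dpow_finsum:
  assumes "x \<in> carrier L" "\<And>i. i \<in> S \<Longrightarrow> s i \<in> carrier L"
  shows "ad_dpow x k (\<Oplus>i\<in>S. s i) = (\<Oplus>i\<in>S. ad_dpow x k (s i))"
  using assms
proof (induction S rule: infinite_finite_induct)
  case (insert i S)
  then show ?case
    by (subst (1 2) M.finsum_insert) (auto simp: ad_dpow_add)
qed auto

lemma bracket_ad_dpow:
  assumes "x \<in> carrier L" "y \<in> carrier L"
  shows "\<lbrakk>x, ad_dpow x k y\<rbrakk> = of_nat (Suc k) \<odot> ad_dpow x (Suc k) y"
proof -
  have "1 / fact k = (of_nat (Suc k) * (1 / fact (Suc k)) :: complex)"
    by (simp add: field_simps del: of_nat_Suc)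
  then show ?thesis
    using assms by (simp add: ad_dpow_def bracket_smult_right del: of_nat_Suc fact_Suc)
qed

lemma ad_dpow_Suc:
  assumes "x \<in> carrier L" "y \<in> carrier L"
  shows "ad_dpow x (Suc k) y = (1 / of_nat (Suc k)) \<odot> \<lbrakk>x, ad_dpow x k y\<rbrakk>"
  using assms by (simp add: bracket_ad_dpow del: of_nat_Suc)

lemma Ad_exp_eq: "Ad_exp L x y = lie_sum L UNIV (\<lambda>k. ad_dpow x k y)"
  by (simp add: Ad_exp_def ad_dpow_def)

lemma Ad_exp_eq_finsum:
  assumes "x \<in> carrier L" "y \<in> carrier L" "\<And>k. k \<ge> N \<Longrightarrow> ad_dpow x k y = \<zero>"
  shows "Ad_exp L x y = (\<Oplus>k\<in>{..<N}. ad_dpow x k y)"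
  unfolding Ad_exp_eq by (rule lie_sum_eq_finsum) (use assms in auto)

lemma ad_dpow_eventually_zero:
  assumes "locally_ad_nilpotent L x" "y \<in> carrier L"
  obtains n where "\<And>k. k \<ge> n \<Longrightarrow> ad_dpow x k y = \<zero>"
proof -
  obtain n where "\<And>k. k \<ge> n \<Longrightarrow> (lie_bracket L x ^^ k) y = \<zero>"
    using nilpotentE[OF assms] by blast
  then show ?thesis by (intro that[of n]) (simp add: ad_dpow_def)
qed

lemma Ad_exp_closed [simp, intro]:
  "\<lbrakk>x \<in> carrier L; y \<in> carrier L\<rbrakk> \<Longrightarrow> Ad_exp L x y \<in> carrier L"
  unfolding Ad_exp_eq by (rule lie_sum_closed) auto

text \<open>Covers both the Leibniz rule for \<open>exp (ad x)\<close> on a bracket and the multiplicativity of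
  \<open>exp\<close> on commuting elements: in both cases \<open>ad x\<close> acts on a doubly indexed family of divided
  powers like a derivation.\<close>

lemma antidiagonal_recursion:
  assumes x: "x \<in> carrier L" and c [simp]: "\<And>k l. c k l \<in> carrier L"
    and t0: "t 0 = c 0 0" and tSuc: "\<And>n. t (Suc n) = (1 / of_nat (Suc n)) \<odot> \<lbrakk>x, t n\<rbrakk>"
    and deriv: "\<And>k l. \<lbrakk>x, c k l\<rbrakk> = of_nat (Suc k) \<odot> c (Suc k) l \<oplus> of_nat (Suc l) \<odot> c k (Suc l)"
  shows "t n = (\<Oplus>k\<in>{..n}. c k (n - k))"
proof (induction n)
  case 0
  then show ?case by (simp add: t0)
next
  case (Suc n)
  \<comment> \<open>The term of degree \<open>Suc n\<close> with first index \<open>k\<close> arises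
    with weight \<open>k\<close> from first index \<open>k - 1\<close>, and with weight
    \<open>Suc n - k\<close> from the same first index. The weights add up to \<open>Suc n\<close>,
    which cancels the divisor in \<open>tSuc\<close>.\<close>
  define d where "d k = of_nat k \<odot> c k (Suc n - k)" for k
  define d' where "d' k = of_nat (Suc n - k) \<odot> c k (Suc n - k)" for k
  have dc [simp]: "d k \<in> carrier L" "d' k \<in> carrier L" for k by (auto simp: d_def d'_def)
  have "\<lbrakk>x, t n\<rbrakk> = (\<Oplus>k\<in>{..n}. \<lbrakk>x, c k (n - k)\<rbrakk>)"
    using x by (simp add: Suc.IH bracket_finsum_right)
  also have "\<dots> = (\<Oplus>k\<in>{..n}. d (Suc k) \<oplus> d' k)"
    by (rule M.finsum_cong') (auto simp: deriv d_def d'_def Suc_diff_le)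
  also have "\<dots> = (\<Oplus>k\<in>{..n}. d (Suc k)) \<oplus> (\<Oplus>k\<in>{..n}. d' k)"
    by (rule M.finsum_addf) auto
  \<comment> \<open>The weights make \<open>d 0\<close> and \<open>d' (Suc n)\<close> vanish, so
    both sums extend to the range \<open>{..Suc n}\<close>.\<close>
  also have "(\<Oplus>k\<in>{..n}. d (Suc k)) = (\<Oplus>k\<in>{..Suc n}. d k)"
    by (subst M.finsum_Suc2) (auto simp: Pi_def, simp add: d_def)
  also have "(\<Oplus>k\<in>{..n}. d' k) = (\<Oplus>k\<in>{..Suc n}. d' k)"
    by (subst M.finsum_Suc) (auto simp: Pi_def, simp add: d'_def)
  also have "(\<Oplus>k\<in>{..Suc n}. d k) \<oplus> (\<Oplus>k\<in>{..Suc n}. d' k) = (\<Oplus>k\<in>{..Suc n}. d k \<oplus> d' k)"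
    by (rule M.finsum_addf [symmetric]) auto
  also have "\<dots> = (\<Oplus>k\<in>{..Suc n}. of_nat (Suc n) \<odot> c k (Suc n - k))"
    by (rule M.finsum_cong')
      (auto simp: d_def d'_def simp flip: scalar_add_left of_nat_add simp del: of_nat_Suc)
  also have "\<dots> = of_nat (Suc n) \<odot> (\<Oplus>k\<in>{..Suc n}. c k (Suc n - k))"
    by (rule scalar_finsum [symmetric]) auto
  finally have *: "\<lbrakk>x, t n\<rbrakk> = \<dots>" .
  have "(\<Oplus>k\<in>{..Suc n}. c k (Suc n - k)) \<in> carrier L"
    by (rule M.finsum_closed) auto
  then show ?case
    unfolding tSuc * by (simp del: of_nat_Suc M.finsum_Suc)
qed

text \<open>Two ways to sum over the triangle \<open>k + l < N\<close>, by antidiagonals and by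
  rows. Passing to \<open>Suc N\<close> adds one entry to each row.\<close>

lemma finsum_antidiagonals:
  fixes c :: "nat \<Rightarrow> nat \<Rightarrow> 'a"
  assumes c [simp]: "\<And>k l. c k l \<in> carrier L"
  shows "(\<Oplus>n\<in>{..<N}. \<Oplus>k\<in>{..n}. c k (n - k)) = (\<Oplus>k\<in>{..<N}. \<Oplus>l\<in>{..<N - k}. c k l)"
proof (induction N)
  case (Suc N)
  have "(\<Oplus>k\<in>{..<Suc N}. \<Oplus>l\<in>{..<Suc N - k}. c k l)
      = (\<Oplus>k\<in>{..<Suc N}. (\<Oplus>l\<in>{..<N - k}. c k l) \<oplus> c k (N - k))"
    by (rule M.finsum_cong') (auto simp: Suc_diff_le finsum_lessThan_Suc)
  also have "\<dots> = (\<Oplus>k\<in>{..<Suc N}. \<Oplus>l\<in>{..<N - k}. c k l) \<oplus> (\<Oplus>k\<in>{..<Suc N}. c k (N - k))"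
    by (rule M.finsum_addf) auto
  also have "(\<Oplus>k\<in>{..<Suc N}. \<Oplus>l\<in>{..<N - k}. c k l) = (\<Oplus>k\<in>{..<N}. \<Oplus>l\<in>{..<N - k}. c k l)"
    by (simp add: finsum_lessThan_Suc)
  also have "\<dots> \<oplus> (\<Oplus>k\<in>{..<Suc N}. c k (N - k))
      = (\<Oplus>n\<in>{..<Suc N}. \<Oplus>k\<in>{..n}. c k (n - k))"
    by (subst (2) finsum_lessThan_Suc) (auto simp: Suc lessThan_Suc_atMost)
  finally show ?case ..
qed simp

text \<open>Cauchy product with finite support: the antidiagonals below \<open>2 * N\<close> cover
  the square \<open>k, l < N\<close> that carries \<open>c\<close>, and all later ones miss
  it.\<close>

lemma lie_sum_antidiagonals:
  assumes c [simp]: "\<And>k l. c k l \<in> carrier L"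
    and c0: "\<And>k l. k \<ge> N \<or> l \<ge> N \<Longrightarrow> c k l = \<zero>"
    and t: "\<And>n. t n = (\<Oplus>k\<in>{..n}. c k (n - k))"
  shows "n \<ge> 2 * N \<Longrightarrow> t n = \<zero>"
    and "lie_sum L UNIV t = (\<Oplus>k\<in>{..<N}. \<Oplus>l\<in>{..<N}. c k l)"
proof -
  have t0: "t n = \<zero>" if "n \<ge> 2 * N" for n
    unfolding t by (rule M.add.finprod_one_eqI) (use that in \<open>auto intro!: c0\<close>)
  then show "n \<ge> 2 * N \<Longrightarrow> t n = \<zero>" .
  have "lie_sum L UNIV t = (\<Oplus>n\<in>{..<2 * N}. t n)"
    by (rule lie_sum_eq_finsum) (auto simp: t0, auto simp: t)
  also have "\<dots> = (\<Oplus>k\<in>{..<2 * N}. \<Oplus>l\<in>{..<2 * N - k}. c k l)"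
    by (simp add: t finsum_antidiagonals)
  also have "\<dots> = (\<Oplus>k\<in>{..<N}. \<Oplus>l\<in>{..<2 * N - k}. c k l)"
    by (rule M.add.finprod_mono_neutral_cong_right)
      (auto simp: c0 intro!: M.add.finprod_one_eqI)
  also have "\<dots> = (\<Oplus>k\<in>{..<N}. \<Oplus>l\<in>{..<N}. c k l)"
    by (rule M.finsum_cong') (auto intro!: finsum_zero_extend simp: c0)
  finally show "lie_sum L UNIV t = (\<Oplus>k\<in>{..<N}. \<Oplus>l\<in>{..<N}. c k l)" .
qed

end

section \<open>Exponentials as automorphisms\<close>

definition lie_automorphism :: "('a, 'm) lie_algebra_scheme \<Rightarrow> ('a \<Rightarrow> 'a) \<Rightarrow> bool" where
  "lie_automorphism L \<phi> \<longleftrightarrow> bij_betw \<phi> (carrier L) (carrier L) \<and>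
     (\<forall>x\<in>carrier L. \<forall>y\<in>carrier L. \<phi> (x \<oplus>\<^bsub>L\<^esub> y) = \<phi> x \<oplus>\<^bsub>L\<^esub> \<phi> y) \<and>
     (\<forall>c. \<forall>x\<in>carrier L. \<phi> (c \<odot>\<^bsub>L\<^esub> x) = c \<odot>\<^bsub>L\<^esub> \<phi> x) \<and>
     (\<forall>x\<in>carrier L. \<forall>y\<in>carrier L. \<phi> \<lbrakk>x, y\<rbrakk>\<^bsub>L\<^esub> = \<lbrakk>\<phi> x, \<phi> y\<rbrakk>\<^bsub>L\<^esub>)"

context complex_lie_algebra
begin

text \<open>The divided powers of \<open>ad x\<close> on a bracket are the convolution of those on
  its two entries. A common vanishing bound \<open>N\<close> turns the double sum into a bracket of
  two finite sums.\<close>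

lemma Ad_exp_bracket:
  assumes x: "locally_ad_nilpotent L x" and y: "y \<in> carrier L" and z: "z \<in> carrier L"
  shows "Ad_exp L x \<lbrakk>y, z\<rbrakk> = \<lbrakk>Ad_exp L x y, Ad_exp L x z\<rbrakk>"
proof -
  note xc = nilpotent_closed [OF x]
  obtain m where m: "\<And>k. k \<ge> m \<Longrightarrow> ad_dpow x k y = \<zero>"
    using ad_dpow_eventually_zero[OF x y] by blast
  obtain n where n: "\<And>k. k \<ge> n \<Longrightarrow> ad_dpow x k z = \<zero>"
    using ad_dpow_eventually_zero[OF x z] by blast
  define N where "N = max m n"
  have N: "ad_dpow x k y = \<zero>" "ad_dpow x k z = \<zero>" if "k \<ge> N" for k
    using m n that by (auto simp: N_def)
  define c where "c k l = \<lbrakk>ad_dpow x k y, ad_dpow x l z\<rbrakk>" for k l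
  have t: "ad_dpow x i \<lbrakk>y, z\<rbrakk> = (\<Oplus>k\<in>{..i}. c k (i - k))" for i
  proof (rule antidiagonal_recursion)
    show "\<lbrakk>x, c k l\<rbrakk> = of_nat (Suc k) \<odot> c (Suc k) l \<oplus> of_nat (Suc l) \<odot> c k (Suc l)" for k l
      unfolding c_def using xc y z
      by (subst bracket_derivation)
        (simp_all add: bracket_ad_dpow bracket_smult_left bracket_smult_right del: of_nat_Suc)
  qed (use xc y z in \<open>auto simp: c_def ad_dpow_Suc simp del: of_nat_Suc\<close>)
  have "Ad_exp L x \<lbrakk>y, z\<rbrakk> = (\<Oplus>k\<in>{..<N}. \<Oplus>l\<in>{..<N}. c k l)"
    unfolding Ad_exp_eq
    by (rule lie_sum_antidiagonals [OF _ _ t]) (use xc y z N in \<open>auto simp: c_def\<close>)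
  also have "\<dots> = (\<Oplus>k\<in>{..<N}. \<lbrakk>ad_dpow x k y, (\<Oplus>l\<in>{..<N}. ad_dpow x l z)\<rbrakk>)"
    unfolding c_def using xc y z by (intro M.finsum_cong') (auto simp: bracket_finsum_right)
  also have "\<dots> = \<lbrakk>(\<Oplus>k\<in>{..<N}. ad_dpow x k y), (\<Oplus>l\<in>{..<N}. ad_dpow x l z)\<rbrakk>"
    using xc y z by (intro bracket_finsum_left [symmetric]) auto
  finally show ?thesis
    using xc y z N by (simp add: Ad_exp_eq_finsum [of x y N] Ad_exp_eq_finsum [of x z N])
qed

lemma ad_commute_pow:
  assumes "x \<in> carrier L" "y \<in> carrier L" "z \<in> carrier L" "\<lbrakk>x, y\<rbrakk> = \<zero>"
  shows "\<lbrakk>y, (lie_bracket L x ^^ k) z\<rbrakk> = (lie_bracket L x ^^ k) \<lbrakk>y, z\<rbrakk>"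
proof (induction k)
  case (Suc k)
  have "\<lbrakk>y, (lie_bracket L x ^^ Suc k) z\<rbrakk> = \<lbrakk>x, \<lbrakk>y, (lie_bracket L x ^^ k) z\<rbrakk>\<rbrakk>"
    using assms bracket_zero_swap[OF _ _ assms(4)]
      bracket_derivation[of y x "(lie_bracket L x ^^ k) z"] by simp
  then show ?case using Suc by simp
qed simp

text \<open>For commuting \<open>x\<close> and \<open>y\<close> the divided powers of
  \<open>ad (x + y)\<close> are the convolution of those of \<open>ad x\<close> and
  \<open>ad y\<close>. Both conclusions come from this double family: its total is the composition,
  and its vanishing in degree \<open>2 * N\<close> shows nilpotency on \<open>z\<close>.\<close>

lemma
  assumes x: "locally_ad_nilpotent L x" and y: "locally_ad_nilpotent L y"
    and z: "z \<in> carrier L" and comm: "\<lbrakk>x, y\<rbrakk> = \<zero>"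
  shows Ad_exp_add: "Ad_exp L (x \<oplus> y) z = Ad_exp L x (Ad_exp L y z)"
    and ad_add_pow_zero: "\<exists>n. (lie_bracket L (x \<oplus> y) ^^ n) z = \<zero>"
proof -
  note xc = nilpotent_closed [OF x] and yc = nilpotent_closed [OF y]
  obtain n where n: "\<And>l. l \<ge> n \<Longrightarrow> ad_dpow y l z = \<zero>"
    using ad_dpow_eventually_zero[OF y z] by blast
  have "\<forall>l. \<exists>m. \<forall>k\<ge>m. ad_dpow x k (ad_dpow y l z) = \<zero>"
    using ad_dpow_eventually_zero[OF x] yc z by (metis ad_dpow_closed)
  then obtain m where m: "\<And>k l. k \<ge> m l \<Longrightarrow> ad_dpow x k (ad_dpow y l z) = \<zero>"
    by metis
  \<comment> \<open>The bound \<open>m l\<close> varies with \<open>l\<close>, but from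
    \<open>l = n\<close> on the inner divided power is zero. A maximum over finitely many
    \<open>l\<close> therefore confines \<open>c\<close> to one square.\<close>
  define N where "N = max n (Max (m ` {..n}))"
  have Y: "Ad_exp L y z = (\<Oplus>l\<in>{..<N}. ad_dpow y l z)"
    by (rule Ad_exp_eq_finsum) (use yc z n in \<open>auto simp: N_def\<close>)
  have m_le: "m l \<le> N" if "l \<le> n" for l
    using that by (auto simp: N_def intro!: max.coboundedI2 Max_ge)
  define c where "c k l = ad_dpow x k (ad_dpow y l z)" for k l
  have c0: "c k l = \<zero>" if "k \<ge> N \<or> l \<ge> N" for k l
  proof (cases "l \<ge> n")
    case True
    then show ?thesis using n xc by (simp add: c_def)
  next
    case False
    then have "k \<ge> m l" using that m_le[of l] by (auto simp: N_def)
    then show ?thesis using m by (simp add: c_def)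
  qed
  have c [simp]: "c k l \<in> carrier L" for k l using xc yc z by (auto simp: c_def)
  have t: "ad_dpow (x \<oplus> y) i z = (\<Oplus>k\<in>{..i}. c k (i - k))" for i
  proof (rule antidiagonal_recursion)
    fix k l
    have "\<lbrakk>y, c k l\<rbrakk> = ad_dpow x k \<lbrakk>y, ad_dpow y l z\<rbrakk>"
      using xc yc z comm by (simp add: c_def ad_dpow_def [of x] bracket_smult_right ad_commute_pow)
    then show "\<lbrakk>x \<oplus> y, c k l\<rbrakk> = of_nat (Suc k) \<odot> c (Suc k) l \<oplus> of_nat (Suc l) \<odot> c k (Suc l)"
      using xc yc z
      by (simp add: c_def bracket_add_left bracket_ad_dpow ad_dpow_scalar del: of_nat_Suc)
  qed (use xc yc z in \<open>auto simp: c_def ad_dpow_Suc [of "x \<oplus> y"] simp del: of_nat_Suc\<close>)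
  have "Ad_exp L (x \<oplus> y) z = (\<Oplus>k\<in>{..<N}. \<Oplus>l\<in>{..<N}. c k l)"
    unfolding Ad_exp_eq by (rule lie_sum_antidiagonals [OF c c0 t])
  also have "\<dots> = (\<Oplus>k\<in>{..<N}. ad_dpow x k (Ad_exp L y z))"
    unfolding Y c_def using xc yc z by (intro M.finsum_cong') (auto simp: ad_dpow_finsum)
  also have "\<dots> = Ad_exp L x (Ad_exp L y z)"
  proof (rule Ad_exp_eq_finsum [symmetric])
    fix k assume "k \<ge> N"
    then show "ad_dpow x k (Ad_exp L y z) = \<zero>"
      unfolding Y using xc yc z c0 [of k]
      by (auto simp: ad_dpow_finsum c_def intro!: M.add.finprod_one_eqI)
  qed (use xc yc z in auto)
  finally show "Ad_exp L (x \<oplus> y) z = Ad_exp L x (Ad_exp L y z)" .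
  have "ad_dpow (x \<oplus> y) (2 * N) z = \<zero>"
    by (rule lie_sum_antidiagonals(1) [OF c c0 t]) auto
  then have "fact (2 * N) \<odot> ad_dpow (x \<oplus> y) (2 * N) z = \<zero>" by simp
  then have "(lie_bracket L (x \<oplus> y) ^^ (2 * N)) z = \<zero>"
    using xc yc z by (simp add: ad_dpow_def)
  then show "\<exists>n. (lie_bracket L (x \<oplus> y) ^^ n) z = \<zero>" ..
qed

lemma nilpotent_add:
  assumes "locally_ad_nilpotent L x" "locally_ad_nilpotent L y" "\<lbrakk>x, y\<rbrakk> = \<zero>"
  shows "locally_ad_nilpotent L (x \<oplus> y)"
  using ad_add_pow_zero[OF assms(1,2) _ assms(3)] assms(1,2)
  by (auto simp: locally_ad_nilpotent_def)

lemma bracket_finsum_zero: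
  assumes "x \<in> carrier L" "\<And>i. i \<in> S \<Longrightarrow> s i \<in> carrier L" "\<And>i. i \<in> S \<Longrightarrow> \<lbrakk>x, s i\<rbrakk> = \<zero>"
  shows "\<lbrakk>x, (\<Oplus>i\<in>S. s i)\<rbrakk> = \<zero>"
  using assms by (simp add: bracket_finsum_right M.add.finprod_one_eqI)

lemma nilpotent_finsum:
  assumes "\<And>i. i \<in> S \<Longrightarrow> locally_ad_nilpotent L (s i)"
    and "\<And>i j. \<lbrakk>i \<in> S; j \<in> S; i \<noteq> j\<rbrakk> \<Longrightarrow> \<lbrakk>s i, s j\<rbrakk> = \<zero>"
  shows "locally_ad_nilpotent L (\<Oplus>i\<in>S. s i)"
  using assms
proof (induction S rule: infinite_finite_induct)
  case (insert i S)
  have sc: "s j \<in> carrier L" if "j \<in> insert i S" for j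
    using insert.prems(1) that nilpotent_closed by blast
  have "\<lbrakk>s i, (\<Oplus>j\<in>S. s j)\<rbrakk> = \<zero>"
    by (rule bracket_finsum_zero) (use sc insert in auto)
  then have "locally_ad_nilpotent L (s i \<oplus> (\<Oplus>j\<in>S. s j))"
    using insert by (intro nilpotent_add) auto
  then show ?case
    using insert.hyps sc by (simp add: M.finsum_insert Pi_def)
qed (auto simp: nilpotent_zero)

lemma Ad_exp_fixed:
  assumes "x \<in> carrier L" "y \<in> carrier L" "\<lbrakk>x, y\<rbrakk> = \<zero>"
  shows "Ad_exp L x y = y"
proof -
  have "ad_dpow x k y = \<zero>" if "k \<ge> 1" for k
    using that assms ad_pow_zero_mono[of x 1 y k] by (simp add: ad_dpow_def)
  then show ?thesis
    using assms by (simp add: Ad_exp_eq_finsum [of x y 1] lessThan_Suc)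
qed

lemma Ad_exp_of_zero: "y \<in> carrier L \<Longrightarrow> Ad_exp L \<zero> y = y"
  by (simp add: Ad_exp_fixed)

lemma Ad_exp_linear:
  assumes "x \<in> carrier L" "y \<in> carrier L" "\<lbrakk>x, \<lbrakk>x, y\<rbrakk>\<rbrakk> = \<zero>"
  shows "Ad_exp L x y = y \<oplus> \<lbrakk>x, y\<rbrakk>"
proof -
  have "ad_dpow x k y = \<zero>" if "k \<ge> 2" for k
    using that assms ad_pow_zero_mono[of x 2 y k]
    by (simp add: ad_dpow_def numeral_2_eq_2)
  then have "Ad_exp L x y = (\<Oplus>k\<in>{..<Suc (Suc 0)}. ad_dpow x k y)"
    using assms by (intro Ad_exp_eq_finsum) (auto simp: numeral_2_eq_2)
  also have "\<dots> = y \<oplus> \<lbrakk>x, y\<rbrakk>"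
    using assms by (subst finsum_lessThan_Suc) (auto simp: lessThan_Suc ad_dpow_def)
  finally show ?thesis .
qed

lemma lie_sum_split_at_3:
  assumes s: "\<And>k. s k \<in> carrier L" and N: "\<And>k. k \<ge> N \<Longrightarrow> s k = \<zero>"
  shows "lie_sum L UNIV s = s 0 \<oplus> s 1 \<oplus> s 2 \<oplus> lie_sum L {3..} s"
proof -
  \<comment> \<open>The bound \<open>N + 3\<close> leaves room for the three initial terms even when
    \<open>N < 3\<close>.\<close>
  have "lie_sum L UNIV s = (\<Oplus>k\<in>{..<N + 3}. s k)"
    by (rule lie_sum_eq_finsum) (use assms in auto)
  also have "{..<N + 3} = {..<3} \<union> {3..<N + 3}" by auto
  also have "(\<Oplus>k\<in>\<dots>. s k) = (\<Oplus>k\<in>{..<3}. s k) \<oplus> (\<Oplus>k\<in>{3..<N + 3}. s k)"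
    by (rule M.finsum_Un_disjoint) (use s in auto)
  also have "(\<Oplus>k\<in>{3..<N + 3}. s k) = lie_sum L {3..} s"
    unfolding lie_sum_def
    by (rule M.add.finprod_mono_neutral_cong_right)
      (use assms in \<open>auto simp: not_le [symmetric] intro!: leI\<close>)
  also have "(\<Oplus>k\<in>{..<3}. s k) = s 0 \<oplus> s 1 \<oplus> s 2"
    using s by (simp add: numeral_3_eq_3 numeral_2_eq_2 lessThan_Suc M.a_ac)
  finally show ?thesis .
qed

text \<open>Scaling by a nonzero \<open>c\<close> preserves the support over which
  \<open>lie_sum\<close> runs, while \<open>c = 0\<close> empties it; hence the case
  distinction.\<close>

lemma lie_sum_scalar:
  assumes s: "\<And>k. k \<in> K \<Longrightarrow> s k \<in> carrier L"
  shows "lie_sum L K (\<lambda>k. c \<odot> s k) = c \<odot> lie_sum L K s"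
proof (cases "c = 0")
  case True
  have "lie_sum L K (\<lambda>k. c \<odot> s k) = lie_sum L K (\<lambda>k. \<zero>)"
    by (rule lie_sum_cong) (use s True in auto)
  moreover have "lie_sum L K s \<in> carrier L" by (rule lie_sum_closed) (use s in auto)
  ultimately show ?thesis using True by (simp add: lie_sum_def)
next
  case False
  have "c \<odot> s k = \<zero> \<longleftrightarrow> s k = \<zero>" if "k \<in> K" for k
  proof
    assume "c \<odot> s k = \<zero>"
    then have "(1 / c) \<odot> (c \<odot> s k) = \<zero>" by simp
    then show "s k = \<zero>" using False s that by simp
  qed simp
  then have "{k \<in> K. c \<odot> s k \<noteq> \<zero>} = {k \<in> K. s k \<noteq> \<zero>}" by blast
  then show ?thesis
    unfolding lie_sum_def using s by (auto intro!: scalar_finsum [symmetric])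
qed

text \<open>The shape of the final formulas: three explicit terms, and a tail written as powers of
  \<open>ad x\<close> on the double bracket, so that a known double bracket can be
  substituted.\<close>

lemma Ad_exp_expand:
  assumes x: "locally_ad_nilpotent L x" and y: "y \<in> carrier L"
  shows "Ad_exp L x y = y \<oplus> \<lbrakk>x, y\<rbrakk> \<oplus> (1 / 2) \<odot> \<lbrakk>x, \<lbrakk>x, y\<rbrakk>\<rbrakk> \<oplus>
    lie_sum L {3..} (\<lambda>k. (1 / fact k) \<odot> (lie_bracket L x ^^ (k - 2)) \<lbrakk>x, \<lbrakk>x, y\<rbrakk>\<rbrakk>)"
proof -
  note xc = nilpotent_closed [OF x]
  obtain N where N: "\<And>k. k \<ge> N \<Longrightarrow> ad_dpow x k y = \<zero>"
    using ad_dpow_eventually_zero[OF x y] by blast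
  have "lie_sum L UNIV (\<lambda>k. ad_dpow x k y) = ad_dpow x 0 y \<oplus> ad_dpow x 1 y \<oplus> ad_dpow x 2 y \<oplus>
      lie_sum L {3..} (\<lambda>k. ad_dpow x k y)"
    by (rule lie_sum_split_at_3) (use N xc y in auto)
  also have "lie_sum L {3..} (\<lambda>k. ad_dpow x k y) =
      lie_sum L {3..} (\<lambda>k. (1 / fact k) \<odot> (lie_bracket L x ^^ (k - 2)) \<lbrakk>x, \<lbrakk>x, y\<rbrakk>\<rbrakk>)"
  proof (rule lie_sum_cong)
    fix k :: nat assume "k \<in> {3..}"
    then have "k = (k - 2) + 2" by simp
    then have "(lie_bracket L x ^^ k) y = (lie_bracket L x ^^ (k - 2)) ((lie_bracket L x ^^ 2) y)"
      by (metis comp_apply funpow_add)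
    then show "ad_dpow x k y = (1 / fact k) \<odot> (lie_bracket L x ^^ (k - 2)) \<lbrakk>x, \<lbrakk>x, y\<rbrakk>\<rbrakk>"
      by (simp add: ad_dpow_def numeral_2_eq_2)
  qed (use xc y in auto)
  finally show ?thesis
    using xc y by (simp add: Ad_exp_eq ad_dpow_def numeral_2_eq_2)
qed

lemma automorphism_closed:
  "\<lbrakk>lie_automorphism L \<phi>; x \<in> carrier L\<rbrakk> \<Longrightarrow> \<phi> x \<in> carrier L"
  by (auto simp: lie_automorphism_def bij_betw_def)

lemma automorphism_add:
  "\<lbrakk>lie_automorphism L \<phi>; x \<in> carrier L; y \<in> carrier L\<rbrakk> \<Longrightarrow> \<phi> (x \<oplus> y) = \<phi> x \<oplus> \<phi> y"
  by (simp add: lie_automorphism_def)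

lemma automorphism_scalar:
  "\<lbrakk>lie_automorphism L \<phi>; x \<in> carrier L\<rbrakk> \<Longrightarrow> \<phi> (c \<odot> x) = c \<odot> \<phi> x"
  by (simp add: lie_automorphism_def)

lemma automorphism_bracket:
  "\<lbrakk>lie_automorphism L \<phi>; x \<in> carrier L; y \<in> carrier L\<rbrakk> \<Longrightarrow> \<phi> \<lbrakk>x, y\<rbrakk> = \<lbrakk>\<phi> x, \<phi> y\<rbrakk>"
  by (simp add: lie_automorphism_def)

lemma automorphism_zero: "lie_automorphism L \<phi> \<Longrightarrow> \<phi> \<zero> = \<zero>"
  using automorphism_scalar[of \<phi> \<zero> 0] automorphism_closed[of \<phi> \<zero>] by simp

text \<open>The inverse is the exponential of \<open>-x\<close>: as \<open>x\<close> and
  \<open>-x\<close> commute, the two compose to the exponential of zero. Linearity holds termwise,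
  and compatibility with brackets is \<open>Ad_exp_bracket\<close>.\<close>

lemma Ad_exp_automorphism:
  assumes x: "locally_ad_nilpotent L x"
  shows "lie_automorphism L (Ad_exp L x)"
proof -
  note xc = nilpotent_closed [OF x]
  let ?x' = "(-1) \<odot> x"
  have x': "locally_ad_nilpotent L ?x'" using x by (rule nilpotent_scalar)
  have sum: "x \<oplus> ?x' = \<zero>" "?x' \<oplus> x = \<zero>"
    using xc by (simp_all add: M.r_neg M.l_neg flip: neg_eq_scalar)
  have comm: "\<lbrakk>x, ?x'\<rbrakk> = \<zero>" "\<lbrakk>?x', x\<rbrakk> = \<zero>"
    using xc by (simp_all add: bracket_smult_left bracket_smult_right)
  have inv: "Ad_exp L x (Ad_exp L ?x' y) = y" "Ad_exp L ?x' (Ad_exp L x y) = y"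
    if "y \<in> carrier L" for y
    using Ad_exp_add[OF x x' that comm(1)] Ad_exp_add[OF x' x that comm(2)] that
    by (simp_all add: sum Ad_exp_of_zero)
  have bij: "bij_betw (Ad_exp L x) (carrier L) (carrier L)"
    by (rule bij_betw_byWitness[where f' = "Ad_exp L ?x'"]) (use inv xc in auto)
  have add: "Ad_exp L x (y \<oplus> z) = Ad_exp L x y \<oplus> Ad_exp L x z"
    if yz: "y \<in> carrier L" "z \<in> carrier L" for y z
  proof -
    obtain m where m: "\<And>k. k \<ge> m \<Longrightarrow> ad_dpow x k y = \<zero>"
      using ad_dpow_eventually_zero[OF x yz(1)] by blast
    obtain n where n: "\<And>k. k \<ge> n \<Longrightarrow> ad_dpow x k z = \<zero>"
      using ad_dpow_eventually_zero[OF x yz(2)] by blast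
    have "Ad_exp L x (y \<oplus> z) = (\<Oplus>k\<in>{..<max m n}. ad_dpow x k y \<oplus> ad_dpow x k z)"
      using xc yz m n by (subst Ad_exp_eq_finsum[where N = "max m n"]) (auto simp: ad_dpow_add)
    also have "\<dots> = (\<Oplus>k\<in>{..<max m n}. ad_dpow x k y) \<oplus> (\<Oplus>k\<in>{..<max m n}. ad_dpow x k z)"
      by (rule M.finsum_addf) (use xc yz in auto)
    finally show ?thesis
      using xc yz m n
      by (simp add: Ad_exp_eq_finsum[of x y "max m n"] Ad_exp_eq_finsum[of x z "max m n"])
  qed
  have scalar: "Ad_exp L x (c \<odot> y) = c \<odot> Ad_exp L x y" if "y \<in> carrier L" for c y
    using xc that by (simp add: Ad_exp_eq ad_dpow_scalar lie_sum_scalar)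
  show ?thesis
    using bij add scalar Ad_exp_bracket[OF x] by (simp add: lie_automorphism_def)
qed

lemma automorphism_ad_pow:
  assumes "lie_automorphism L \<phi>" "x \<in> carrier L" "y \<in> carrier L"
  shows "\<phi> ((lie_bracket L x ^^ n) y) = (lie_bracket L (\<phi> x) ^^ n) (\<phi> y)"
  using assms(2,3) by (induction n) (simp_all add: automorphism_bracket [OF assms(1)])

lemma automorphism_finsum:
  assumes "lie_automorphism L \<phi>" "\<And>i. i \<in> S \<Longrightarrow> s i \<in> carrier L"
  shows "\<phi> (\<Oplus>i\<in>S. s i) = (\<Oplus>i\<in>S. \<phi> (s i))"
  using assms(2)
proof (induction S rule: infinite_finite_induct)
  case (insert i S)
  then show ?case
    by (subst (1 2) M.finsum_insert) (auto simp: automorphism_add [OF assms(1)] automorphism_closed [OF assms(1)])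
qed (auto simp: automorphism_zero [OF assms(1)])

text \<open>The rule that moves one exponential past another. Since \<open>\<phi>\<close>
  intertwines \<open>ad x\<close> with \<open>ad (\<phi> x)\<close>, it also carries over the bound
  beyond which the terms vanish.\<close>

lemma automorphism_Ad_exp:
  assumes \<phi>: "lie_automorphism L \<phi>" and x: "locally_ad_nilpotent L x" and y: "y \<in> carrier L"
  shows "\<phi> (Ad_exp L x y) = Ad_exp L (\<phi> x) (\<phi> y)"
proof -
  note xc = nilpotent_closed [OF x]
  obtain N where N: "\<And>k. k \<ge> N \<Longrightarrow> ad_dpow x k y = \<zero>"
    using ad_dpow_eventually_zero[OF x y] by blast
  have dpow: "\<phi> (ad_dpow x k y) = ad_dpow (\<phi> x) k (\<phi> y)" for k
    using xc y by (simp add: ad_dpow_def automorphism_scalar [OF \<phi>] automorphism_ad_pow [OF \<phi>])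
  have "\<phi> (Ad_exp L x y) = (\<Oplus>k\<in>{..<N}. ad_dpow (\<phi> x) k (\<phi> y))"
    using xc y by (simp add: Ad_exp_eq_finsum[OF _ _ N] automorphism_finsum [OF \<phi>] dpow)
  also have "\<dots> = Ad_exp L (\<phi> x) (\<phi> y)"
    by (rule Ad_exp_eq_finsum [symmetric])
      (use xc y N in \<open>auto simp: automorphism_closed [OF \<phi>] automorphism_zero [OF \<phi>] simp flip: dpow\<close>)
  finally show ?thesis .
qed

text \<open>By surjectivity an arbitrary \<open>z\<close> is some \<open>\<phi> y\<close>, and an
  exponent that works for \<open>x\<close> on \<open>y\<close> works for \<open>\<phi> x\<close> on
  \<open>z\<close>.\<close>

lemma automorphism_nilpotent:
  assumes \<phi>: "lie_automorphism L \<phi>" and x: "locally_ad_nilpotent L x"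
  shows "locally_ad_nilpotent L (\<phi> x)"
  unfolding locally_ad_nilpotent_def
proof (intro conjI ballI)
  note xc = nilpotent_closed [OF x]
  show "\<phi> x \<in> carrier L" by (rule automorphism_closed [OF \<phi> xc])
  fix z assume "z \<in> carrier L"
  then have "z \<in> \<phi> ` carrier L"
    using \<phi> by (simp add: lie_automorphism_def bij_betw_def)
  then obtain y where y: "z = \<phi> y" "y \<in> carrier L" by (rule imageE)
  obtain n where n: "(lie_bracket L x ^^ n) y = \<zero>"
    using x y(2) unfolding locally_ad_nilpotent_def by blast
  show "\<exists>n. (lie_bracket L (\<phi> x) ^^ n) z = \<zero>"
    using automorphism_ad_pow [OF \<phi> xc y(2), of n]
    unfolding n y(1) automorphism_zero [OF \<phi>] by (intro exI [of _ n]) simp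
qed

end

section \<open>Parents in rooted trees\<close>

lemma symp_cartan_graph: "generalized_cartan_matrix A \<Longrightarrow> symp (cartan_graph A)"
  unfolding symp_def generalized_cartan_matrix_def cartan_graph_def by (metis order_le_less)

lemma not_cartan_graph_eq_zero:
  "\<lbrakk>generalized_cartan_matrix A; i \<noteq> j; \<not> cartan_graph A i j\<rbrakk> \<Longrightarrow> A i j = 0"
  unfolding generalized_cartan_matrix_def cartan_graph_def by (metis order_le_less)

lemma parent_of_adjacent: "parent_of G r u v \<Longrightarrow> G u v"
  by (auto simp: parent_of_def simple_path_def successively_append_iff)

text \<open>A path that starts at \<open>r\<close>, has at least two vertices and repeats none
  cannot end at \<open>r\<close>.\<close>

lemma not_parent_of_root: "\<not> parent_of G r u r"
proof
  assume "parent_of G r u r"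
  then obtain p where p: "distinct (p @ [u, r])" "hd (p @ [u, r]) = r"
    by (auto simp: parent_of_def simple_path_def)
  then show False by (cases p) auto
qed

lemma successively_rev_sym:
  assumes "symp G"
  shows "successively G (rev p) \<longleftrightarrow> successively G p"
proof -
  have "(\<lambda>x y. G y x) = G" using assms by (auto simp: fun_eq_iff dest: sympD)
  then show ?thesis using successively_rev[of G p] by metis
qed

text \<open>Two different parents would give two paths from the root to \<open>v\<close>; from their
  last branching point on, these close up to a cycle through \<open>v\<close>.\<close>

lemma parent_of_unique:
  assumes sym: "symp G" and tree: "tree_graph G"
    and u: "parent_of G r u v" and u': "parent_of G r u' v"
  shows "u = u'"
proof (rule ccontr)
  assume "u \<noteq> u'"
  obtain p where p: "simple_path G ((p @ [u]) @ [v])" "hd (p @ [u]) = r"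
    using u unfolding parent_of_def by (metis append.assoc append_Cons append_Nil hd_append2 append_is_Nil_conv list.distinct(1))
  obtain q where q: "simple_path G ((q @ [u']) @ [v])" "hd (q @ [u']) = r"
    using u' unfolding parent_of_def by (metis append.assoc append_Cons append_Nil hd_append2 append_is_Nil_conv list.distinct(1))
  define P Q where "P = p @ [u]" and "Q = q @ [u']"
  have P: "P \<noteq> []" "distinct P" "v \<notin> set P" "successively G P" "last P = u" "G u v"
    using p by (auto simp: P_def simple_path_def successively_append_iff)
  have Q: "Q \<noteq> []" "distinct Q" "v \<notin> set Q" "successively G Q" "last Q = u'" "G u' v"
    using q by (auto simp: Q_def simple_path_def successively_append_iff)
  have "r \<in> set P" "r \<in> set Q"
    using p(2) q(2) P(1) Q(1) unfolding P_def Q_def by (metis hd_in_set)+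
  \<comment> \<open>Both paths contain the root, so there is a last vertex \<open>w\<close> of
    \<open>P\<close> on \<open>Q\<close>; the rest \<open>P2\<close> of \<open>P\<close> avoids
    \<open>Q\<close>.\<close>
  then obtain P1 w P2 where PS: "P = P1 @ w # P2" "w \<in> set Q" "\<forall>x\<in>set P2. x \<notin> set Q"
    using split_list_last_prop[of P "\<lambda>x. x \<in> set Q"] by blast
  then obtain Q1 Q2 where QS: "Q = Q1 @ w # Q2" by (meson split_list)
  \<comment> \<open>From \<open>u\<close> back along \<open>P\<close> to \<open>w\<close>, then
    along \<open>Q\<close> to \<open>u'\<close> and on to \<open>v\<close>; the edge from
    \<open>v\<close> to \<open>u\<close> closes the cycle.\<close>
  define C where "C = rev P2 @ w # Q2 @ [v]"
  have "last P = (if P2 = [] then w else last P2)" "last Q = (if Q2 = [] then w else last Q2)"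
    by (simp_all add: PS QS)
  have "successively G (w # P2)" "successively G (w # Q2)"
    using P(4) Q(4) by (simp_all add: PS QS successively_append_iff)
  then have "successively G (rev (w # P2))" "successively G (w # Q2)"
    using successively_rev_sym[OF sym] by blast+
  moreover have "last (w # Q2) = u'" using Q(5) by (simp add: QS)
  ultimately have "successively G (rev (w # P2) @ Q2 @ [v])"
    using Q(6) by (auto simp: successively_append_iff successively_Cons split: if_splits)
  then have "successively G C" by (simp add: C_def)
  moreover have "distinct C"
    using P(2,3) Q(2,3) PS QS by (auto simp: C_def)
  moreover have "3 \<le> length C"
  proof -
    \<comment> \<open>If both were empty, then \<open>u = w = u'\<close>.\<close>
    have "P2 \<noteq> [] \<or> Q2 \<noteq> []" using P(5) Q(5) \<open>u \<noteq> u'\<close> by (auto simp: PS QS)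
    then show ?thesis by (cases P2; cases Q2) (auto simp: C_def)
  qed
  moreover have "hd C = u" using P(5) by (cases P2 rule: rev_cases) (auto simp: C_def PS)
  moreover have "last C = v" by (simp add: C_def)
  ultimately have "\<exists>p. simple_path G p \<and> 3 \<le> length p \<and> G (last p) (hd p)"
    using sympD[OF sym P(6)] by (intro exI[of _ C]) (auto simp: simple_path_def C_def)
  then show False using tree by (simp add: tree_graph_def)
qed

text \<open>Take the path from the root to \<open>u\<close>. If it misses \<open>v\<close>,
  appending \<open>v\<close> makes \<open>u\<close> the parent. If it meets \<open>v\<close>, then
  \<open>v\<close> is its penultimate vertex, since otherwise the stretch from \<open>v\<close> to
  \<open>u\<close> would close to a cycle.\<close>

lemma adjacent_imp_parent:
  assumes sym: "symp G" and tree: "tree_graph G"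
    and uv: "G u v" "u \<noteq> v"
  shows "parent_of G r u v \<or> parent_of G r v u"
proof -
  obtain p where p: "simple_path G p" "hd p = r" "last p = u"
    using tree unfolding tree_graph_def by blast
  then have "p \<noteq> []" by (simp add: simple_path_def)
  then obtain q where q: "p = q @ [u]" using p(3) by (metis append_butlast_last_id)
  show ?thesis
  proof (cases "v \<in> set p")
    case False
    then have "simple_path G (q @ [u, v])"
      using p uv by (auto simp: q simple_path_def successively_append_iff)
    moreover have "hd (q @ [u, v]) = r" using p(2) q by (cases q) auto
    ultimately show ?thesis unfolding parent_of_def by blast
  next
    case True
    then obtain s t where st: "p = s @ v # t" by (meson split_list)
    have t: "last t = u" "t \<noteq> []" using p(3) st uv by (auto split: if_splits)
    show ?thesis
    proof (cases "tl t = []")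
      case True
      then have "p = s @ [v, u]" using st t by (cases t) auto
      then show ?thesis using p unfolding parent_of_def by blast
    next
      case False
      then have "3 \<le> length (v # t)" using t by (cases t; cases "tl t") auto
      moreover have "simple_path G (v # t)"
        using p(1) by (auto simp: st simple_path_def successively_append_iff)
      moreover have "G (last (v # t)) (hd (v # t))" using uv t by simp
      ultimately show ?thesis using tree unfolding tree_graph_def by blast
    qed
  qed
qed

section \<open>Chevalley generators\<close>

lemma (in complex_lie_algebra) Ad_exp_quadratic:
  assumes x: "locally_ad_nilpotent L x" and y: "y \<in> carrier L" and 3: "\<lbrakk>x, \<lbrakk>x, \<lbrakk>x, y\<rbrakk>\<rbrakk>\<rbrakk> = \<zero>"
  shows "Ad_exp L x y = y \<oplus> \<lbrakk>x, y\<rbrakk> \<oplus> (1 / 2) \<odot> \<lbrakk>x, \<lbrakk>x, y\<rbrakk>\<rbrakk>"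
proof -
  note xc = nilpotent_closed [OF x]
  have "lie_sum L {3..} (\<lambda>k. (1 / fact k) \<odot> (lie_bracket L x ^^ (k - 2)) \<lbrakk>x, \<lbrakk>x, y\<rbrakk>\<rbrakk>)
      = lie_sum L {3..} (\<lambda>k. \<zero>)"
  proof (rule lie_sum_cong)
    fix k :: nat assume "k \<in> {3..}"
    then have "(lie_bracket L x ^^ (k - 2)) \<lbrakk>x, \<lbrakk>x, y\<rbrakk>\<rbrakk> = \<zero>"
      using 3 xc by (intro ad_pow_zero_mono[of x 1 _ "k - 2"]) auto
    then show "(1 / fact k) \<odot> (lie_bracket L x ^^ (k - 2)) \<lbrakk>x, \<lbrakk>x, y\<rbrakk>\<rbrakk> = \<zero>" by simp
  qed simp
  then show ?thesis
    using xc y by (simp add: Ad_exp_expand [OF x y] lie_sum_def)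
qed

lemma (in complex_lie_algebra) Ad_prod_fixed:
  assumes "y \<in> carrier L" "\<And>x. x \<in> set xs \<Longrightarrow> x \<in> carrier L \<and> \<lbrakk>x, y\<rbrakk> = \<zero>"
  shows "Ad_prod L xs y = y"
  using assms(2) by (induction xs) (auto simp: Ad_prod_def Ad_exp_fixed [OF _ assms(1)])

text \<open>The sl2 situation \<open>x = f i\<close>, \<open>y = e i\<close>: two applications of
  \<open>ad x\<close> lead to a multiple of \<open>x\<close>, which the third one kills.\<close>

lemma (in complex_lie_algebra) ad_cubed_zero:
  assumes "x \<in> carrier L" "y \<in> carrier L" "\<lbrakk>x, \<lbrakk>y, x\<rbrakk>\<rbrakk> = c \<odot> x"
  shows "(lie_bracket L x ^^ Suc (Suc (Suc 0))) y = \<zero>"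
  using assms bracket_swap[of x y] by (simp add: bracket_smult_right)

text \<open>Collects the relations that the computation uses, so that it can be done in an abstract
  \<open>L\<close>. Local nilpotency of \<open>f i\<close> is assumed here and derived for the
  presented algebra in \<open>chevalley_generators_cartan\<close>.\<close>

locale chevalley_generators = complex_lie_algebra L
  for L :: "('a, 'm) lie_algebra_scheme" (structure) +
  fixes A :: "'i \<Rightarrow> 'i \<Rightarrow> int" and e f :: "'i \<Rightarrow> 'a"
  assumes e_closed [simp, intro]: "e i \<in> carrier L"
    and f_closed [simp, intro]: "f i \<in> carrier L"
    and bracket_e_f: "i \<noteq> j \<Longrightarrow> \<lbrakk>e i, f j\<rbrakk> = \<zero>"
    and bracket_h_f: "\<lbrakk>\<lbrakk>e i, f i\<rbrakk>, f j\<rbrakk> = (- of_int (A i j)) \<odot> f j"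
    and serre_f: "i \<noteq> j \<Longrightarrow> (lie_bracket L (f i) ^^ nat (1 - A i j)) (f j) = \<zero>"
    and f_nilpotent: "locally_ad_nilpotent L (f i)"
    and cartan_diag: "A i i = 2"
begin

definition u_elem :: "complex \<Rightarrow> 'i \<Rightarrow> 'a" where
  "u_elem c i = e i \<oplus> c \<odot> \<lbrakk>e i, f i\<rbrakk> \<ominus> c\<^sup>2 \<odot> f i"

lemma u_elem_closed [simp, intro]: "u_elem c i \<in> carrier L"
  by (auto simp: u_elem_def)

lemma bracket_f_e: "i \<noteq> j \<Longrightarrow> \<lbrakk>f j, e i\<rbrakk> = \<zero>"
  by (simp add: bracket_e_f bracket_zero_swap)

lemma bracket_f_f: "i \<noteq> j \<Longrightarrow> A i j = 0 \<Longrightarrow> \<lbrakk>f i, f j\<rbrakk> = \<zero>"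
  using serre_f[of i j] by simp

lemma bracket_f_f_f: "i \<noteq> j \<Longrightarrow> A i j = -1 \<Longrightarrow> \<lbrakk>f i, \<lbrakk>f i, f j\<rbrakk>\<rbrakk> = \<zero>"
  using serre_f[of i j] by (simp add: numeral_2_eq_2)

lemma bracket_f_h: "\<lbrakk>f j, \<lbrakk>e i, f i\<rbrakk>\<rbrakk> = of_int (A i j) \<odot> f j"
  using bracket_swap[of "f j" "\<lbrakk>e i, f i\<rbrakk>"] by (simp add: bracket_h_f)

lemma nilpotent_scaled_f: "locally_ad_nilpotent L (c \<odot> f i)"
  by (rule nilpotent_scalar [OF f_nilpotent])

text \<open>An sl2 computation: the second bracket is \<open>-2 * c^2\<close> times
  \<open>f i\<close>, the 2 being the diagonal Cartan entry, and the third one vanishes. It exhibits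
  \<open>u_elem\<close> as a conjugate of \<open>e i\<close>.\<close>

lemma Ad_exp_f_e: "Ad_exp L ((- c) \<odot> f i) (e i) = u_elem c i"
proof -
  have 1: "\<lbrakk>(- c) \<odot> f i, e i\<rbrakk> = c \<odot> \<lbrakk>e i, f i\<rbrakk>"
    using bracket_swap[of "f i" "e i"] by (simp add: bracket_smult_left)
  have 2: "\<lbrakk>(- c) \<odot> f i, c \<odot> \<lbrakk>e i, f i\<rbrakk>\<rbrakk> = (- 2 * c\<^sup>2) \<odot> f i"
    by (simp add: bracket_smult_left bracket_smult_right bracket_f_h cartan_diag power2_eq_square mult_ac)
  have "Ad_exp L ((- c) \<odot> f i) (e i) = e i \<oplus> c \<odot> \<lbrakk>e i, f i\<rbrakk> \<oplus> (1 / 2) \<odot> ((- 2 * c\<^sup>2) \<odot> f i)"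
    by (subst Ad_exp_quadratic)
      (auto simp: 1 2 nilpotent_scaled_f bracket_smult_left bracket_smult_right)
  then show ?thesis by (simp add: u_elem_def minus_eq_scalar)
qed

lemma Ad_exp_f_u: "Ad_exp L (c \<odot> f i) (u_elem c i) = e i"
proof -
  have "c \<odot> f i \<oplus> (- c) \<odot> f i = \<zero>"
    by (simp flip: scalar_add_left)
  then show ?thesis
    unfolding Ad_exp_f_e [symmetric]
    by (subst Ad_exp_add [symmetric])
      (auto simp: nilpotent_scaled_f bracket_smult_left bracket_smult_right Ad_exp_of_zero)
qed

text \<open>This allows the factors of vertices not adjacent to \<open>i\<close> to be
  dropped.\<close>

lemma bracket_f_u:
  assumes "i \<noteq> k" "A i k = 0" "A k i = 0"
  shows "\<lbrakk>f k, u_elem c i\<rbrakk> = \<zero>"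
  using assms
  by (simp add: u_elem_def minus_eq_scalar bracket_add_right bracket_smult_right bracket_f_e
      bracket_f_h bracket_f_f)

text \<open>For the entry \<open>-1\<close> the Serre relation has exponent 2, so the exponential on
  \<open>f j\<close> stops after the linear term. For the second part, \<open>e i\<close> commutes
  with \<open>f j\<close>, and \<open>[e i, [f i, f j]] = [h i, f j] = f j\<close> because
  \<open>- A i j = 1\<close>.\<close>

lemma conjugate_f:
  assumes "i \<noteq> j" "A i j = -1"
  shows "Ad_exp L (c \<odot> f i) (f j) = f j \<oplus> c \<odot> \<lbrakk>f i, f j\<rbrakk>"
    and "\<lbrakk>f j \<oplus> c \<odot> \<lbrakk>f i, f j\<rbrakk>, e i\<rbrakk> = (- c) \<odot> f j"
proof -
  show "Ad_exp L (c \<odot> f i) (f j) = f j \<oplus> c \<odot> \<lbrakk>f i, f j\<rbrakk>"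
    using assms
    by (subst Ad_exp_linear) (auto simp: bracket_smult_left bracket_smult_right bracket_f_f_f)
  have "\<lbrakk>e i, \<lbrakk>f i, f j\<rbrakk>\<rbrakk> = f j"
    using assms by (subst bracket_derivation) (auto simp: bracket_h_f bracket_e_f)
  then have "\<lbrakk>\<lbrakk>f i, f j\<rbrakk>, e i\<rbrakk> = (-1) \<odot> f j"
    using bracket_swap[of "\<lbrakk>f i, f j\<rbrakk>" "e i"] by simp
  then show "\<lbrakk>f j \<oplus> c \<odot> \<lbrakk>f i, f j\<rbrakk>, e i\<rbrakk> = (- c) \<odot> f j"
    using assms by (simp add: bracket_add_left bracket_smult_left bracket_f_e)
qed

text \<open>The further assumption \<open>A j i = -1\<close> makes the conjugate
  \<open>f j + c [f i, f j]\<close> commute with \<open>f j\<close>. As its bracket with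
  \<open>e i\<close> is a multiple of \<open>f j\<close>, the series stops after the linear
  term.\<close>

lemma Ad_exp_chain:
  assumes "i \<noteq> j" "A i j = -1" "A j i = -1"
  shows "Ad_exp L (c \<odot> f i) (Ad_exp L (d \<odot> f j) (u_elem c i)) = e i \<oplus> (- d * c) \<odot> f j"
proof -
  let ?P = "f j \<oplus> c \<odot> \<lbrakk>f i, f j\<rbrakk>"
  note \<phi> = Ad_exp_automorphism [OF nilpotent_scaled_f [of c i]]
  have 1: "\<lbrakk>d \<odot> ?P, e i\<rbrakk> = (- d * c) \<odot> f j"
    using conjugate_f(2) [OF assms(1,2)] by (simp add: bracket_smult_left)
  have "\<lbrakk>\<lbrakk>f i, f j\<rbrakk>, f j\<rbrakk> = (-1) \<odot> \<lbrakk>f j, (-1) \<odot> \<lbrakk>f j, f i\<rbrakk>\<rbrakk>"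
    using bracket_swap[of "\<lbrakk>f i, f j\<rbrakk>" "f j"] bracket_swap[of "f i" "f j"] by simp
  also have "\<dots> = \<zero>"
    using bracket_f_f_f[of j i] assms by (simp add: bracket_smult_right)
  finally have 2: "\<lbrakk>?P, f j\<rbrakk> = \<zero>"
    by (simp add: bracket_add_left bracket_smult_left)
  have "Ad_exp L (c \<odot> f i) (Ad_exp L (d \<odot> f j) (u_elem c i)) = Ad_exp L (d \<odot> ?P) (e i)"
    using conjugate_f(1) [OF assms(1,2)]
    by (simp add: automorphism_Ad_exp [OF \<phi> nilpotent_scaled_f] automorphism_scalar [OF \<phi>]
        Ad_exp_f_u)
  also have "\<dots> = e i \<oplus> (- d * c) \<odot> f j"
    using 1 2 by (subst Ad_exp_linear) (auto simp: bracket_smult_left bracket_smult_right)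
  finally show ?thesis .
qed

text \<open>Nothing is assumed on \<open>A j i\<close>, so \<open>P\<close> need not commute with
  \<open>\<psi> (f j)\<close> and the whole series remains. In the application \<open>j\<close> is
  the root, \<open>i\<close> is in \<open>J\<close>, and \<open>\<psi>\<close> is the exponential of
  the other summands of \<open>f_plus\<close>; it fixes \<open>e i\<close> and \<open>f i\<close>,
  so it only replaces \<open>f j\<close> by \<open>\<psi> (f j)\<close>.\<close>

lemma Ad_exp_leaf:
  fixes c d b :: complex
  assumes "i \<noteq> j" "A i j = -1" and \<psi>: "lie_automorphism L \<psi>" "\<psi> (e i) = e i" "\<psi> (f i) = f i"
  defines "P \<equiv> \<psi> (f j) \<oplus> c \<odot> \<lbrakk>f i, \<psi> (f j)\<rbrakk>" and "W \<equiv> \<lbrakk>\<lbrakk>f i, \<psi> (f j)\<rbrakk>, \<psi> (f j)\<rbrakk>"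
  assumes b: "b = - d * c"
  shows "locally_ad_nilpotent L P"
    and "\<psi> (Ad_exp L (c \<odot> f i) (Ad_exp L (d \<odot> f j) (u_elem c i))) =
      e i \<oplus> b \<odot> \<psi> (f j) \<ominus> (b\<^sup>2 / 2) \<odot> W
        \<ominus> c\<^sup>2 \<odot> lie_sum L {3..} (\<lambda>k. (d ^ k / fact k) \<odot> (lie_bracket L P ^^ (k - 2)) W)"
proof -
  let ?P = "f j \<oplus> c \<odot> \<lbrakk>f i, f j\<rbrakk>"
  note \<phi> = Ad_exp_automorphism [OF nilpotent_scaled_f [of c i]]
  note \<psi>_simps = automorphism_scalar [OF \<psi>(1)] automorphism_add [OF \<psi>(1)]
    automorphism_bracket [OF \<psi>(1)] \<psi>(2,3)
  have fc [simp]: "\<psi> (f j) \<in> carrier L" by (simp add: automorphism_closed [OF \<psi>(1)])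
  have Pc [simp]: "P \<in> carrier L" and Wc [simp]: "W \<in> carrier L" by (simp_all add: P_def W_def)
  have \<psi>P: "\<psi> ?P = P" by (simp add: P_def \<psi>_simps)
  have "locally_ad_nilpotent L ?P"
    using automorphism_nilpotent[OF \<phi> f_nilpotent[of j]] conjugate_f(1)[OF assms(1,2)] by simp
  then show nil: "locally_ad_nilpotent L P"
    using automorphism_nilpotent[OF \<psi>(1)] \<psi>P by fastforce
  have "\<psi> \<lbrakk>?P, e i\<rbrakk> = \<psi> ((- c) \<odot> f j)" using conjugate_f(2)[OF assms(1,2)] by simp
  then have "\<lbrakk>P, e i\<rbrakk> = (- c) \<odot> \<psi> (f j)"
    by (subst (asm) automorphism_bracket [OF \<psi>(1)]) (auto simp: \<psi>P \<psi>(2) automorphism_scalar [OF \<psi>(1)])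
  then have 1: "\<lbrakk>d \<odot> P, e i\<rbrakk> = b \<odot> \<psi> (f j)"
    by (simp add: bracket_smult_left b)
  \<comment> \<open>Only the second summand of \<open>P\<close> contributes, giving
    \<open>d * b * c = - b^2\<close>.\<close>
  have 2: "\<lbrakk>d \<odot> P, b \<odot> \<psi> (f j)\<rbrakk> = (- b\<^sup>2) \<odot> W"
    by (simp add: P_def W_def bracket_add_left bracket_smult_left bracket_smult_right b
        power2_eq_square mult_ac)
  have "\<psi> (Ad_exp L (c \<odot> f i) (Ad_exp L (d \<odot> f j) (u_elem c i)))
      = \<psi> (Ad_exp L (d \<odot> ?P) (e i))"
    using conjugate_f(1) [OF assms(1,2)]
    by (simp add: automorphism_Ad_exp [OF \<phi> nilpotent_scaled_f] automorphism_scalar [OF \<phi>]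
        Ad_exp_f_u)
  also have "\<dots> = Ad_exp L (d \<odot> P) (e i)"
    using \<open>locally_ad_nilpotent L ?P\<close>
    by (subst automorphism_Ad_exp [OF \<psi>(1)])
      (auto intro: nilpotent_scalar simp: automorphism_scalar [OF \<psi>(1)] \<psi>P \<psi>(2))
  also have "\<dots> = e i \<oplus> b \<odot> \<psi> (f j) \<oplus> (1 / 2) \<odot> ((- b\<^sup>2) \<odot> W) \<oplus>
      lie_sum L {3..} (\<lambda>k. (1 / fact k) \<odot> (lie_bracket L (d \<odot> P) ^^ (k - 2)) ((- b\<^sup>2) \<odot> W))"
    by (subst Ad_exp_expand) (auto intro: nilpotent_scalar nil simp: 1 2)
  also have "lie_sum L {3..} (\<lambda>k. (1 / fact k) \<odot> (lie_bracket L (d \<odot> P) ^^ (k - 2)) ((- b\<^sup>2) \<odot> W))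
      = lie_sum L {3..} (\<lambda>k. (- c\<^sup>2) \<odot> ((d ^ k / fact k) \<odot> (lie_bracket L P ^^ (k - 2)) W))"
  proof (rule lie_sum_cong)
    fix k :: nat assume "k \<in> {3..}"
    \<comment> \<open>Since \<open>b^2 = c^2 * d^2\<close>, the factor \<open>d ^ (k - 2)\<close>
      from rescaling \<open>P\<close> combines to \<open>c^2 * d ^ k\<close>; this needs
      \<open>k\<close> to be at least 2.\<close>
    then have "d ^ k = d ^ Suc (Suc (k - 2))" by (intro arg_cong [of _ _ "(^) d"]) simp
    then have "d ^ k = d * (d * d ^ (k - 2))" by (simp only: power_Suc)
    then show "(1 / fact k) \<odot> (lie_bracket L (d \<odot> P) ^^ (k - 2)) ((- b\<^sup>2) \<odot> W)
        = (- c\<^sup>2) \<odot> ((d ^ k / fact k) \<odot> (lie_bracket L P ^^ (k - 2)) W)"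
      by (simp add: ad_scalar_pow ad_pow_scalar b power2_eq_square mult_ac)
  qed auto
  also have "\<dots> = (- c\<^sup>2) \<odot> lie_sum L {3..} (\<lambda>k. (d ^ k / fact k) \<odot> (lie_bracket L P ^^ (k - 2)) W)"
    by (rule lie_sum_scalar) auto
  finally show "\<psi> (Ad_exp L (c \<odot> f i) (Ad_exp L (d \<odot> f j) (u_elem c i))) =
      e i \<oplus> b \<odot> \<psi> (f j) \<ominus> (b\<^sup>2 / 2) \<odot> W
        \<ominus> c\<^sup>2 \<odot> lie_sum L {3..} (\<lambda>k. (d ^ k / fact k) \<odot> (lie_bracket L P ^^ (k - 2)) W)"
    by (simp add: minus_eq_scalar lie_sum_closed)
qed

text \<open>In the application \<open>v\<close> is \<open>f_rest\<close>, and the hypotheses say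
  that it behaves like a single \<open>f j\<close> with \<open>A r j = -1\<close>. Conjugation by
  the exponential of \<open>c f r\<close> turns \<open>v\<close> into \<open>v + c [f r, v]\<close>;
  then \<open>\<psi>\<close>, the exponential of \<open>f_plus\<close>, fixes \<open>v\<close> and
  \<open>e r\<close> and replaces \<open>f r\<close> by its image.\<close>

lemma Ad_exp_root:
  fixes c :: complex
  assumes v: "locally_ad_nilpotent L v" and Fe: "\<lbrakk>v, e r\<rbrakk> = \<zero>" and hF: "\<lbrakk>\<lbrakk>e r, f r\<rbrakk>, v\<rbrakk> = v"
    and ffF: "\<lbrakk>f r, \<lbrakk>f r, v\<rbrakk>\<rbrakk> = \<zero>"
    and \<psi>: "lie_automorphism L \<psi>" "\<psi> (e r) = e r" "\<psi> v = v"
  defines "D \<equiv> v \<oplus> c \<odot> \<lbrakk>\<psi> (f r), v\<rbrakk>" and "W \<equiv> \<lbrakk>v, \<lbrakk>v, \<psi> (f r)\<rbrakk>\<rbrakk>"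
  shows "locally_ad_nilpotent L D"
    and "\<psi> (Ad_exp L (c \<odot> f r) (Ad_exp L v (u_elem c r))) =
      e r \<ominus> c \<odot> v \<ominus> (c\<^sup>2 / 2) \<odot> W
        \<ominus> c\<^sup>2 \<odot> lie_sum L {3..} (\<lambda>k. (1 / fact k) \<odot> (lie_bracket L D ^^ (k - 2)) W)"
proof -
  let ?D = "v \<oplus> c \<odot> \<lbrakk>f r, v\<rbrakk>"
  note \<phi> = Ad_exp_automorphism [OF nilpotent_scaled_f [of c r]]
  note Fc [simp] = nilpotent_closed [OF v]
  have fc [simp]: "\<psi> (f r) \<in> carrier L" by (simp add: automorphism_closed [OF \<psi>(1)])
  have Dc [simp]: "D \<in> carrier L" and Wc [simp]: "W \<in> carrier L" by (simp_all add: D_def W_def)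
  have \<psi>D: "\<psi> ?D = D"
    by (simp add: D_def automorphism_scalar [OF \<psi>(1)] automorphism_add [OF \<psi>(1)]
        automorphism_bracket [OF \<psi>(1)] \<psi>(3))
  have \<phi>v: "Ad_exp L (c \<odot> f r) v = ?D"
    using ffF by (subst Ad_exp_linear) (auto simp: bracket_smult_left bracket_smult_right)
  have nil0: "locally_ad_nilpotent L ?D"
    using automorphism_nilpotent[OF \<phi> v] \<phi>v by simp
  then show nil: "locally_ad_nilpotent L D"
    using automorphism_nilpotent[OF \<psi>(1)] \<psi>D by fastforce
  have "\<lbrakk>e r, \<lbrakk>f r, v\<rbrakk>\<rbrakk> = v"
    using Fe hF bracket_zero_swap[of v "e r"] by (subst bracket_derivation) auto
  then have "\<lbrakk>\<lbrakk>f r, v\<rbrakk>, e r\<rbrakk> = (-1) \<odot> v"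
    using bracket_swap[of "\<lbrakk>f r, v\<rbrakk>" "e r"] by simp
  then have "\<lbrakk>?D, e r\<rbrakk> = (- c) \<odot> v"
    using Fe by (simp add: bracket_add_left bracket_smult_left)
  then have "\<psi> \<lbrakk>?D, e r\<rbrakk> = \<psi> ((- c) \<odot> v)" by simp
  then have 1: "\<lbrakk>D, e r\<rbrakk> = (- c) \<odot> v"
    by (subst (asm) automorphism_bracket [OF \<psi>(1)])
      (auto simp: \<psi>D \<psi>(2,3) automorphism_scalar [OF \<psi>(1)])
  have "\<lbrakk>\<lbrakk>\<psi> (f r), v\<rbrakk>, v\<rbrakk> = W"
    using bracket_swap[of "\<lbrakk>\<psi> (f r), v\<rbrakk>" v] bracket_swap[of "\<psi> (f r)" v]
    by (simp add: W_def bracket_smult_right)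
  then have 2: "\<lbrakk>D, (- c) \<odot> v\<rbrakk> = (- c\<^sup>2) \<odot> W"
    by (simp add: D_def bracket_add_left bracket_smult_left bracket_smult_right power2_eq_square)
  have "\<psi> (Ad_exp L (c \<odot> f r) (Ad_exp L v (u_elem c r))) = \<psi> (Ad_exp L ?D (e r))"
    by (simp add: automorphism_Ad_exp [OF \<phi> v] \<phi>v Ad_exp_f_u)
  also have "\<dots> = Ad_exp L D (e r)"
    by (subst automorphism_Ad_exp [OF \<psi>(1) nil0]) (auto simp: \<psi>D \<psi>(2))
  also have "\<dots> = e r \<oplus> (- c) \<odot> v \<oplus> (1 / 2) \<odot> ((- c\<^sup>2) \<odot> W) \<oplus>
      lie_sum L {3..} (\<lambda>k. (1 / fact k) \<odot> (lie_bracket L D ^^ (k - 2)) ((- c\<^sup>2) \<odot> W))"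
    by (subst Ad_exp_expand) (auto intro: nil simp: 1 2)
  also have "lie_sum L {3..} (\<lambda>k. (1 / fact k) \<odot> (lie_bracket L D ^^ (k - 2)) ((- c\<^sup>2) \<odot> W))
      = lie_sum L {3..} (\<lambda>k. (- c\<^sup>2) \<odot> ((1 / fact k) \<odot> (lie_bracket L D ^^ (k - 2)) W))"
    by (rule lie_sum_cong) (auto simp: ad_pow_scalar)
  also have "\<dots> = (- c\<^sup>2) \<odot> lie_sum L {3..} (\<lambda>k. (1 / fact k) \<odot> (lie_bracket L D ^^ (k - 2)) W)"
    by (rule lie_sum_scalar) auto
  finally show "\<psi> (Ad_exp L (c \<odot> f r) (Ad_exp L v (u_elem c r))) =
      e r \<ominus> c \<odot> v \<ominus> (c\<^sup>2 / 2) \<odot> W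
        \<ominus> c\<^sup>2 \<odot> lie_sum L {3..} (\<lambda>k. (1 / fact k) \<odot> (lie_bracket L D ^^ (k - 2)) W)"
    by (simp add: minus_eq_scalar lie_sum_closed)
qed

end

text \<open>The relations hold by construction. Local nilpotency spreads from the generators to all
  elements because \<open>ad (f i)\<close> is a derivation.\<close>

lemma chevalley_generators_cartan:
  assumes gcm: "generalized_cartan_matrix A"
  shows "chevalley_generators (cartan_lie_algebra A) A (chevalley_e A) (chevalley_f A)"
proof -
  let ?R = "cartan_relations A" and ?L = "cartan_lie_algebra A"
    and ?e = "chevalley_e A" and ?f = "chevalley_f A"
  interpret complex_lie_algebra ?L
    unfolding cartan_lie_algebra_def by (rule complex_lie_algebra_presented)
  note simps = presented_lie_algebra_simps [of ?R, folded cartan_lie_algebra_def]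
  have closed: "?e i \<in> carrier ?L" "?f i \<in> carrier ?L" for i
    by (auto simp: simps chevalley_e_def chevalley_f_def)
  have relI: "lie_class ?R s = lie_class ?R t" if "(s, t) \<in> ?R" for s t
    using that by (simp add: lie_class_eq_iff lie_cong.rel)
  have ef: "\<lbrakk>?e i, ?f j\<rbrakk>\<^bsub>?L\<^esub> = \<zero>\<^bsub>?L\<^esub>" if "i \<noteq> j" for i j
  proof -
    have "(Brk (Gen (E i)) (Gen (F j)), if i = j then H_term i else Zero) \<in> ?R"
      unfolding cartan_relations_def by blast
    then show ?thesis
      using relI that by (simp add: chevalley_e_def chevalley_f_def simps)
  qed
  have hf: "\<lbrakk>\<lbrakk>?e i, ?f i\<rbrakk>\<^bsub>?L\<^esub>, ?f j\<rbrakk>\<^bsub>?L\<^esub> = (- of_int (A i j)) \<odot>\<^bsub>?L\<^esub> ?f j" for i j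
  proof -
    have "(Brk (H_term i) (Gen (F j)), Scale (- of_int (A i j)) (Gen (F j))) \<in> ?R"
      unfolding cartan_relations_def by blast
    then show ?thesis
      using relI by (simp add: chevalley_e_def chevalley_f_def simps)
  qed
  have ad_pow: "(lie_bracket ?L (?f i) ^^ n) (?f j) =
      lie_class ?R ((Brk (Gen (F i)) ^^ n) (Gen (F j)))" for i j n
    by (induction n) (simp_all add: chevalley_f_def simps)
  have serre: "(lie_bracket ?L (?f i) ^^ nat (1 - A i j)) (?f j) = \<zero>\<^bsub>?L\<^esub>" if "i \<noteq> j" for i j
  proof -
    have "((Brk (Gen (F i)) ^^ nat (1 - A i j)) (Gen (F j)), Zero) \<in> ?R"
      unfolding cartan_relations_def using that by blast
    then show ?thesis unfolding ad_pow simps by (rule relI)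
  qed
  have cl: "lie_class ?R t \<in> carrier ?L" for t by (simp add: simps(1))
  \<comment> \<open>Every element is the class of a term, so induction on terms reaches the whole
    algebra.\<close>
  have nil: "\<exists>n. (lie_bracket ?L (?f i) ^^ n) (lie_class ?R t) = \<zero>\<^bsub>?L\<^esub>" for i t
  proof (induction t)
    case (Gen x)
    show ?case
    proof (cases x)
      case (E j)
      \<comment> \<open>Three applications suffice for \<open>i = j\<close> by sl2; for
        \<open>i \<noteq> j\<close> the first one already gives zero.\<close>
      have "(lie_bracket ?L (?f i) ^^ Suc (Suc (Suc 0))) (?e j) = \<zero>\<^bsub>?L\<^esub>"
      proof (cases "i = j")
        case True
        have "\<lbrakk>?f i, \<lbrakk>?e i, ?f i\<rbrakk>\<^bsub>?L\<^esub>\<rbrakk>\<^bsub>?L\<^esub> = of_int (A i i) \<odot>\<^bsub>?L\<^esub> ?f i"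
          using bracket_swap[of "?f i" "\<lbrakk>?e i, ?f i\<rbrakk>\<^bsub>?L\<^esub>"] by (simp add: closed hf)
        then show ?thesis unfolding True [symmetric] by (rule ad_cubed_zero [OF closed(2,1)])
      next
        case False
        have "\<lbrakk>?f i, ?e j\<rbrakk>\<^bsub>?L\<^esub> = \<zero>\<^bsub>?L\<^esub>"
          by (rule bracket_zero_swap [OF closed ef [OF False [symmetric]]])
        then show ?thesis by (simp add: closed)
      qed
      then show ?thesis unfolding E chevalley_e_def by (rule exI)
    next
      case (F j)
      show ?thesis
      proof (cases "i = j")
        case True
        have "(lie_bracket ?L (?f i) ^^ Suc 0) (?f i) = \<zero>\<^bsub>?L\<^esub>" by (simp add: closed)
        then show ?thesis unfolding F True chevalley_f_def by (rule exI)
      next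
        case False
        show ?thesis using serre [OF False] unfolding F chevalley_f_def by (rule exI)
      qed
    qed
  next
    case Zero
    show ?case by (intro exI [of _ 0]) (simp add: simps)
  next
    case (Add s t)
    then obtain m n where mn: "(lie_bracket ?L (?f i) ^^ m) (lie_class ?R s) = \<zero>\<^bsub>?L\<^esub>"
      "(lie_bracket ?L (?f i) ^^ n) (lie_class ?R t) = \<zero>\<^bsub>?L\<^esub>" by blast
    have "(lie_bracket ?L (?f i) ^^ (m + n)) (lie_class ?R s \<oplus>\<^bsub>?L\<^esub> lie_class ?R t) = \<zero>\<^bsub>?L\<^esub>"
      by (rule ad_pow_add_zero [OF _ _ _ mn]) (use closed(2) cl in auto)
    then show ?case unfolding simps(3-5) by (rule exI)
  next
    case (Scale c t)
    then obtain n where "(lie_bracket ?L (?f i) ^^ n) (lie_class ?R t) = \<zero>\<^bsub>?L\<^esub>" by blast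
    then have "(lie_bracket ?L (?f i) ^^ n) (c \<odot>\<^bsub>?L\<^esub> lie_class ?R t) = \<zero>\<^bsub>?L\<^esub>"
      using ad_pow_scalar [OF closed(2) cl] by simp
    then show ?case unfolding simps(3-5) by (rule exI)
  next
    case (Brk s t)
    then obtain m n where mn: "(lie_bracket ?L (?f i) ^^ m) (lie_class ?R s) = \<zero>\<^bsub>?L\<^esub>"
      "(lie_bracket ?L (?f i) ^^ n) (lie_class ?R t) = \<zero>\<^bsub>?L\<^esub>" by blast
    have "(lie_bracket ?L (?f i) ^^ (m + n)) \<lbrakk>lie_class ?R s, lie_class ?R t\<rbrakk>\<^bsub>?L\<^esub> = \<zero>\<^bsub>?L\<^esub>"
      by (rule ad_pow_bracket_zero [OF _ _ _ mn]) (use closed(2) cl in auto)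
    then show ?case unfolding simps(3-5) by (rule exI)
  qed
  show ?thesis
  proof unfold_locales
    show "locally_ad_nilpotent ?L (?f i)" for i
      using nil closed(2) [of i] unfolding locally_ad_nilpotent_def simps(1) by blast
    show "A i i = 2" for i using gcm by (simp add: generalized_cartan_matrix_def)
  qed (use closed ef hf serre in auto)
qed

section \<open>Conical trees\<close>

text \<open>The nilpotency claims certify that the exponentials and tails are genuine finite sums
  and not the default value of \<open>lie_sum\<close>. The list \<open>xs\<close> is an arbitrary
  enumeration in which parents precede children, so every admissible order of the product is
  covered.\<close>

theorem theorem2p5:
  fixes A :: "'i::finite \<Rightarrow> 'i \<Rightarrow> int"
    and r :: 'i
    and J :: "'i set"
    and a :: "'i \<Rightarrow> complex"
    and xs :: "'i list"
  assumes gcm: "generalized_cartan_matrix A"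
    and G: "G = cartan_graph A"
    and conical: "conical_tree G r"
    and J: "J \<subseteq> {i \<in> children G r r. leaf G r i}"
    and A_outside: "\<And>i j. \<lbrakk>i \<notin> J; j \<notin> J; i \<noteq> j; j \<noteq> r\<rbrakk> \<Longrightarrow> A i j \<in> {0, -1}"
    and A_J: "\<And>i. i \<in> J \<Longrightarrow> A i r = -1"
    and L: "L = cartan_lie_algebra A"
    and e: "e = chevalley_e A"
    and f: "f = chevalley_f A"
    and u: "\<And>i. u i = e i \<oplus>\<^bsub>L\<^esub> a i \<odot>\<^bsub>L\<^esub> \<lbrakk>e i, f i\<rbrakk>\<^bsub>L\<^esub> \<ominus>\<^bsub>L\<^esub> (a i)\<^sup>2 \<odot>\<^bsub>L\<^esub> f i"
    and f_plus: "f_plus = (\<Oplus>\<^bsub>L\<^esub> j \<in> J. a j \<odot>\<^bsub>L\<^esub> f j)"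
    and f_rest: "f_rest = (\<Oplus>\<^bsub>L\<^esub> j \<in> children G r r - J. a j \<odot>\<^bsub>L\<^esub> f j)"
    and f'_r: "f' r = Ad_exp L f_plus (f r)"
    and f'_J: "\<And>i. i \<in> J \<Longrightarrow> f' i = Ad_exp L (f_plus \<ominus>\<^bsub>L\<^esub> a i \<odot>\<^bsub>L\<^esub> f i) (f r)"
    and xs: "distinct xs" "set xs = - insert r J"
    and xs_decreasing: "sorted_wrt (\<lambda>i j. \<not> parent_of G r j i) xs"
    and g: "g = f_plus # a r \<odot>\<^bsub>L\<^esub> f r # map (\<lambda>i. a i \<odot>\<^bsub>L\<^esub> f i) xs"
    and b: "\<And>i. i \<in> J \<Longrightarrow> b i = - a r * a i"
  shows
    "(\<forall>x \<in> set g. locally_ad_nilpotent L x) \<and>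
     (\<forall>i \<in> J. locally_ad_nilpotent L (f_plus \<ominus>\<^bsub>L\<^esub> a i \<odot>\<^bsub>L\<^esub> f i) \<and>
              locally_ad_nilpotent L (f' i \<oplus>\<^bsub>L\<^esub> a i \<odot>\<^bsub>L\<^esub> \<lbrakk>f i, f' i\<rbrakk>\<^bsub>L\<^esub>)) \<and>
     locally_ad_nilpotent L (f_rest \<oplus>\<^bsub>L\<^esub> a r \<odot>\<^bsub>L\<^esub> \<lbrakk>f' r, f_rest\<rbrakk>\<^bsub>L\<^esub>) \<and>
     (\<forall>i \<in> J. Ad_prod L g (u i) =
       e i \<oplus>\<^bsub>L\<^esub> b i \<odot>\<^bsub>L\<^esub> f' i
         \<ominus>\<^bsub>L\<^esub> ((b i)\<^sup>2 / 2) \<odot>\<^bsub>L\<^esub> \<lbrakk>\<lbrakk>f i, f' i\<rbrakk>\<^bsub>L\<^esub>, f' i\<rbrakk>\<^bsub>L\<^esub>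
         \<ominus>\<^bsub>L\<^esub> (a i)\<^sup>2 \<odot>\<^bsub>L\<^esub> lie_sum L {3..} (\<lambda>k. (a r ^ k / fact k) \<odot>\<^bsub>L\<^esub>
              (lie_bracket L (f' i \<oplus>\<^bsub>L\<^esub> a i \<odot>\<^bsub>L\<^esub> \<lbrakk>f i, f' i\<rbrakk>\<^bsub>L\<^esub>) ^^ (k - 2))
                \<lbrakk>\<lbrakk>f i, f' i\<rbrakk>\<^bsub>L\<^esub>, f' i\<rbrakk>\<^bsub>L\<^esub>)) \<and>
     Ad_prod L g (u r) =
       e r \<ominus>\<^bsub>L\<^esub> a r \<odot>\<^bsub>L\<^esub> f_rest
         \<ominus>\<^bsub>L\<^esub> ((a r)\<^sup>2 / 2) \<odot>\<^bsub>L\<^esub> \<lbrakk>f_rest, \<lbrakk>f_rest, f' r\<rbrakk>\<^bsub>L\<^esub>\<rbrakk>\<^bsub>L\<^esub>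
         \<ominus>\<^bsub>L\<^esub> (a r)\<^sup>2 \<odot>\<^bsub>L\<^esub> lie_sum L {3..} (\<lambda>k. (1 / fact k) \<odot>\<^bsub>L\<^esub>
              (lie_bracket L (f_rest \<oplus>\<^bsub>L\<^esub> a r \<odot>\<^bsub>L\<^esub> \<lbrakk>f' r, f_rest\<rbrakk>\<^bsub>L\<^esub>) ^^ (k - 2))
                \<lbrakk>f_rest, \<lbrakk>f_rest, f' r\<rbrakk>\<^bsub>L\<^esub>\<rbrakk>\<^bsub>L\<^esub>) \<and>
     (\<forall>i. i \<noteq> r \<longrightarrow> i \<notin> J \<longrightarrow> Ad_prod L g (u i) =
       (if leaf G r i then e i
        else let i' = the_elem (children G r i) in e i \<oplus>\<^bsub>L\<^esub> (- a i' * a i) \<odot>\<^bsub>L\<^esub> f i'))"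
proof -

  \<comment> \<open>Cartan entries read off from the tree\<close>
  have sym: "symp G" unfolding G by (rule symp_cartan_graph [OF gcm])
  have tree: "tree_graph G" using conical by (simp add: conical_tree_def)
  have only_child: "v = w" if "k \<noteq> r" "parent_of G r k v" "parent_of G r k w" for k v w
    using conical that by (auto simp: conical_tree_def children_def)
  have adj: "parent_of G r i j \<or> parent_of G r j i" if "i \<noteq> j" "A i j \<noteq> 0" for i j
    using adjacent_imp_parent[OF sym tree, of i j] not_cartan_graph_eq_zero[OF gcm, of i j] that G
    by blast
  have parent_neg: "A i j \<noteq> 0" "A j i \<noteq> 0" "i \<noteq> j" if "parent_of G r i j" for i j
    using parent_of_adjacent[OF that] sympD[OF sym parent_of_adjacent[OF that]] by (auto simp: G cartan_graph_def)
  note parent_unique = parent_of_unique[OF sym tree]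
  \<comment> \<open>If two children of the root were adjacent, one of them would be a second parent
    of the other.\<close>
  have A_C: "A i j = 0" if "parent_of G r r i" "parent_of G r r j" "i \<noteq> j" for i j
    using adj[of i j] parent_unique that parent_neg(3) not_parent_of_root by metis
  have JC: "parent_of G r r i" "i \<noteq> r" "\<not> parent_of G r i k" if "i \<in> J" for i k
    using J that parent_neg(3) by (auto simp: children_def leaf_def)
  \<comment> \<open>A leaf attached to the root has the root as its only neighbour.\<close>
  have A_J0: "A i k = 0" "A k i = 0" if "i \<in> J" "k \<noteq> i" "k \<noteq> r" for i k
    using adj[of i k] adj[of k i] JC[OF that(1)] parent_unique that by metis+
  interpret chevalley_generators L A e f
    unfolding L e f by (rule chevalley_generators_cartan [OF gcm])
  have u': "u i = u_elem (a i) i" for i by (simp add: u u_elem_def)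
  \<comment> \<open>Both \<open>f_plus\<close> and \<open>f_rest\<close> are sums of this kind over
    sets of children of the root, whose \<open>f j\<close> commute.\<close>
  define S where "S K = (\<Oplus>\<^bsub>L\<^esub> j \<in> K. a j \<odot>\<^bsub>L\<^esub> f j)" for K
  define C where "C = children G r r"
  have C_iff: "i \<in> C \<longleftrightarrow> parent_of G r r i" for i by (simp add: C_def children_def)
  have JsubC: "J \<subseteq> C" using JC(1) by (auto simp: C_iff)
  have rC: "r \<notin> C" by (simp add: C_iff not_parent_of_root)
  have S_eq: "f_plus = S J" "f_rest = S (C - J)" by (simp_all add: f_plus f_rest S_def C_def)
  have Sc [simp]: "S K \<in> carrier L" for K
    unfolding S_def by (rule M.finsum_closed) auto
  have nilS: "locally_ad_nilpotent L (S K)" if "K \<subseteq> C" for K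
    unfolding S_def
    using that A_C C_iff
    by (intro nilpotent_finsum)
      (auto simp: nilpotent_scaled_f bracket_smult_left bracket_smult_right bracket_f_f subset_iff)
  have S_zero: "\<lbrakk>S K, y\<rbrakk>\<^bsub>L\<^esub> = \<zero>\<^bsub>L\<^esub>"
    if "\<And>j. j \<in> K \<Longrightarrow> \<lbrakk>f j, y\<rbrakk>\<^bsub>L\<^esub> = \<zero>\<^bsub>L\<^esub>" "y \<in> carrier L" for K y
    unfolding S_def using that
    by (subst bracket_finsum_left) (auto simp: bracket_smult_left intro!: M.add.finprod_one_eqI)
  have S_zero_right: "\<lbrakk>y, S K\<rbrakk>\<^bsub>L\<^esub> = \<zero>\<^bsub>L\<^esub>"
    if "\<And>j. j \<in> K \<Longrightarrow> \<lbrakk>f j, y\<rbrakk>\<^bsub>L\<^esub> = \<zero>\<^bsub>L\<^esub>" "y \<in> carrier L" for K y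
    by (rule bracket_zero_swap [OF Sc that(2) S_zero [OF that]])
  have S_insert: "S (insert i K) = a i \<odot>\<^bsub>L\<^esub> f i \<oplus>\<^bsub>L\<^esub> S K" if "i \<notin> K" for i K
    unfolding S_def using that by (subst M.finsum_insert) auto
  have Ad_g: "Ad_prod L g y = Ad_exp L (S J) (Ad_exp L (a r \<odot>\<^bsub>L\<^esub> f r)
      (Ad_prod L (map (\<lambda>i. a i \<odot>\<^bsub>L\<^esub> f i) xs) y))" for y
    by (simp add: g Ad_prod_def S_eq)
  have fixed_list: "Ad_prod L (map (\<lambda>i. a i \<odot>\<^bsub>L\<^esub> f i) zs) y = y"
    if "y \<in> carrier L" "\<And>k. k \<in> set zs \<Longrightarrow> \<lbrakk>f k, y\<rbrakk>\<^bsub>L\<^esub> = \<zero>\<^bsub>L\<^esub>" for zs y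
    using that by (intro Ad_prod_fixed) (auto simp: bracket_smult_left)

  \<comment> \<open>The leaves in \<open>J\<close>\<close>
  have case_J: "locally_ad_nilpotent L (f_plus \<ominus>\<^bsub>L\<^esub> a i \<odot>\<^bsub>L\<^esub> f i) \<and>
      locally_ad_nilpotent L (f' i \<oplus>\<^bsub>L\<^esub> a i \<odot>\<^bsub>L\<^esub> \<lbrakk>f i, f' i\<rbrakk>\<^bsub>L\<^esub>) \<and>
      Ad_prod L g (u i) =
       e i \<oplus>\<^bsub>L\<^esub> b i \<odot>\<^bsub>L\<^esub> f' i
         \<ominus>\<^bsub>L\<^esub> ((b i)\<^sup>2 / 2) \<odot>\<^bsub>L\<^esub> \<lbrakk>\<lbrakk>f i, f' i\<rbrakk>\<^bsub>L\<^esub>, f' i\<rbrakk>\<^bsub>L\<^esub>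
         \<ominus>\<^bsub>L\<^esub> (a i)\<^sup>2 \<odot>\<^bsub>L\<^esub> lie_sum L {3..} (\<lambda>k. (a r ^ k / fact k) \<odot>\<^bsub>L\<^esub>
              (lie_bracket L (f' i \<oplus>\<^bsub>L\<^esub> a i \<odot>\<^bsub>L\<^esub> \<lbrakk>f i, f' i\<rbrakk>\<^bsub>L\<^esub>) ^^ (k - 2))
                \<lbrakk>\<lbrakk>f i, f' i\<rbrakk>\<^bsub>L\<^esub>, f' i\<rbrakk>\<^bsub>L\<^esub>)" if i: "i \<in> J" for i
  proof -
    let ?p = "S (J - {i})"
    note ir = JC(2)[OF i]
    have SJ: "S J = a i \<odot>\<^bsub>L\<^esub> f i \<oplus>\<^bsub>L\<^esub> ?p"
      using S_insert[of i "J - {i}"] i by (simp add: insert_absorb)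
    have p: "f_plus \<ominus>\<^bsub>L\<^esub> a i \<odot>\<^bsub>L\<^esub> f i = ?p"
      by (simp add: S_eq SJ M.a_comm [of "a i \<odot>\<^bsub>L\<^esub> f i" ?p] a_minus_def M.a_assoc M.r_neg)
    have nilp: "locally_ad_nilpotent L ?p" using JsubC by (intro nilS) auto
    have pf: "\<lbrakk>?p, f i\<rbrakk>\<^bsub>L\<^esub> = \<zero>\<^bsub>L\<^esub>"
      by (rule S_zero) (use A_C JC i in \<open>auto intro!: bracket_f_f\<close>)
    have pe: "\<lbrakk>?p, e i\<rbrakk>\<^bsub>L\<^esub> = \<zero>\<^bsub>L\<^esub>"
      by (rule S_zero) (auto intro!: bracket_f_e)
    note \<psi> = Ad_exp_automorphism[OF nilp]
    have f'i: "f' i = Ad_exp L ?p (f r)" using f'_J[OF i] p by simp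
    \<comment> \<open>The summand of \<open>i\<close> commutes with the others, so its exponential
      splits off and can act first.\<close>
    have split: "Ad_exp L (S J) y = Ad_exp L ?p (Ad_exp L (a i \<odot>\<^bsub>L\<^esub> f i) y)"
      if "y \<in> carrier L" for y
      using Ad_exp_add[OF nilp nilpotent_scaled_f that] pf
      by (simp add: SJ M.a_comm bracket_smult_right)
    \<comment> \<open>As \<open>i\<close> is adjacent to \<open>r\<close> only, the factors from
      \<open>xs\<close> drop out, leaving the triple product of \<open>Ad_exp_leaf\<close>.\<close>
    have "Ad_prod L (map (\<lambda>i. a i \<odot>\<^bsub>L\<^esub> f i) xs) (u_elem (a i) i) = u_elem (a i) i"
    proof (rule fixed_list)
      fix k assume "k \<in> set xs"
      then have "k \<noteq> i" "k \<noteq> r" using xs(2) i by auto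
      then show "\<lbrakk>f k, u_elem (a i) i\<rbrakk>\<^bsub>L\<^esub> = \<zero>\<^bsub>L\<^esub>"
        using A_J0[OF i, of k] by (intro bracket_f_u) auto
    qed simp
    then have "Ad_prod L g (u i) = Ad_exp L ?p (Ad_exp L (a i \<odot>\<^bsub>L\<^esub> f i)
        (Ad_exp L (a r \<odot>\<^bsub>L\<^esub> f r) (u_elem (a i) i)))"
      by (simp add: Ad_g u' split)
    then show ?thesis
      using Ad_exp_leaf[OF ir A_J[OF i] \<psi> Ad_exp_fixed[OF _ _ pe] Ad_exp_fixed[OF _ _ pf] b[OF i]]
        nilp
      by (simp add: p f'i)
  qed

  \<comment> \<open>The root\<close>
  have A_r: "A r j = -1" if "j \<in> C - J" for j
  proof -
    have "parent_of G r r j" "j \<notin> J" "r \<notin> J" using that C_iff JC(2) by auto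
    then show ?thesis using A_outside[of r j] parent_neg[of r j] by auto
  qed
  \<comment> \<open>Induction over suffixes, because the last factors act first. The factor of a
    child of \<open>r\<close> joins the exponent; any other factor fixes both the exponent and
    \<open>u r\<close>. Keeping the prefix \<open>ys\<close> gives access to the ordering of
    \<open>xs\<close>.\<close>
  have suffix: "Ad_prod L (map (\<lambda>i. a i \<odot>\<^bsub>L\<^esub> f i) zs) (u r) = Ad_exp L (S (set zs \<inter> C)) (u r)"
    if "xs = ys @ zs" for ys zs
    using that
  proof (induction zs arbitrary: ys)
    case Nil
    then show ?case by (simp add: Ad_prod_def S_def Ad_exp_of_zero u')
  next
    case (Cons k zs)
    have k: "k \<noteq> r" "k \<notin> J" "k \<notin> set zs" using Cons.prems xs by auto
    have nilz: "locally_ad_nilpotent L (S (set zs \<inter> C))" by (intro nilS) auto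
    have "Ad_prod L (map (\<lambda>i. a i \<odot>\<^bsub>L\<^esub> f i) (k # zs)) (u r)
        = Ad_exp L (a k \<odot>\<^bsub>L\<^esub> f k) (Ad_prod L (map (\<lambda>i. a i \<odot>\<^bsub>L\<^esub> f i) zs) (u r))"
      by (simp add: Ad_prod_def)
    also have "\<dots> = Ad_exp L (a k \<odot>\<^bsub>L\<^esub> f k) (Ad_exp L (S (set zs \<inter> C)) (u r))"
      using Cons.IH[of "ys @ [k]"] Cons.prems by simp
    also have "\<dots> = Ad_exp L (S (set (k # zs) \<inter> C)) (u r)"
    proof (cases "k \<in> C")
      case True
      have "\<lbrakk>f k, S (set zs \<inter> C)\<rbrakk>\<^bsub>L\<^esub> = \<zero>\<^bsub>L\<^esub>"
        using True A_C C_iff k by (intro S_zero_right) (auto intro!: bracket_f_f)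
      moreover have "set (k # zs) \<inter> C = insert k (set zs \<inter> C)" using True by auto
      ultimately show ?thesis
        using k nilz
        by (simp add: S_insert Ad_exp_add nilpotent_scaled_f bracket_smult_left u')
    next
      case False
      have Ak: "A r k = 0" "A k r = 0"
        using adj[of r k] adj[of k r] False C_iff not_parent_of_root k(1) by metis+
      then have ku: "\<lbrakk>a k \<odot>\<^bsub>L\<^esub> f k, u r\<rbrakk>\<^bsub>L\<^esub> = \<zero>\<^bsub>L\<^esub>"
        using k by (simp add: u' bracket_smult_left bracket_f_u)
      \<comment> \<open>The order excludes that the later \<open>j\<close> is the parent of
        \<open>k\<close>, and the parent of \<open>j\<close> is \<open>r\<close>, not
        \<open>k\<close>.\<close>
      have "A j k = 0" if j: "j \<in> set zs \<inter> C" for j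
      proof (rule ccontr)
        assume "A j k \<noteq> 0"
        moreover have "j \<noteq> k" using j k by auto
        ultimately have "parent_of G r j k \<or> parent_of G r k j" using adj by blast
        moreover have "\<not> parent_of G r j k"
          using xs_decreasing j Cons.prems by (auto simp: sorted_wrt_append)
        moreover have "\<not> parent_of G r k j" using parent_unique j C_iff k(1) by blast
        ultimately show False by blast
      qed
      then have "\<lbrakk>f k, S (set zs \<inter> C)\<rbrakk>\<^bsub>L\<^esub> = \<zero>\<^bsub>L\<^esub>"
        using k by (intro S_zero_right) (auto intro!: bracket_f_f)
      then have "Ad_exp L (a k \<odot>\<^bsub>L\<^esub> f k) (S (set zs \<inter> C)) = S (set zs \<inter> C)"
        by (intro Ad_exp_fixed) (auto simp: bracket_smult_left)
      moreover have "Ad_exp L (a k \<odot>\<^bsub>L\<^esub> f k) (u r) = u r"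
        using ku by (intro Ad_exp_fixed) (auto simp: u')
      moreover have "set (k # zs) \<inter> C = set zs \<inter> C" using False by auto
      ultimately show ?thesis
        using automorphism_Ad_exp[OF Ad_exp_automorphism[OF nilpotent_scaled_f[of "a k" k]] nilz, of "u r"]
        by (simp add: u')
    qed
    finally show ?case .
  qed
  have "set xs \<inter> C = C - J" using xs(2) rC by auto
  then have Ad_xs_r: "Ad_prod L (map (\<lambda>i. a i \<odot>\<^bsub>L\<^esub> f i) xs) (u r) = Ad_exp L f_rest (u_elem (a r) r)"
    using suffix[of "[]" xs] by (simp add: S_eq u')
  have nil_rest: "locally_ad_nilpotent L f_rest" unfolding S_eq by (rule nilS) auto
  have nil_plus: "locally_ad_nilpotent L f_plus" unfolding S_eq by (rule nilS [OF JsubC])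
  have root: "\<lbrakk>f_rest, e r\<rbrakk>\<^bsub>L\<^esub> = \<zero>\<^bsub>L\<^esub>"
    unfolding S_eq using rC by (intro S_zero) (auto intro!: bracket_f_e)
  \<comment> \<open>All summands of \<open>f_rest\<close> are eigenvectors of
    \<open>[e r, f r]\<close> for the same eigenvalue \<open>- A r j = 1\<close>.\<close>
  have "\<lbrakk>\<lbrakk>e r, f r\<rbrakk>\<^bsub>L\<^esub>, f_rest\<rbrakk>\<^bsub>L\<^esub> = (\<Oplus>\<^bsub>L\<^esub> j \<in> C - J. \<lbrakk>\<lbrakk>e r, f r\<rbrakk>\<^bsub>L\<^esub>, a j \<odot>\<^bsub>L\<^esub> f j\<rbrakk>\<^bsub>L\<^esub>)"
    unfolding S_eq S_def by (rule bracket_finsum_right) auto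
  also have "\<dots> = f_rest"
    unfolding S_eq S_def using A_r
    by (intro M.finsum_cong') (auto simp: bracket_smult_right bracket_h_f)
  finally have h_rest: "\<lbrakk>\<lbrakk>e r, f r\<rbrakk>\<^bsub>L\<^esub>, f_rest\<rbrakk>\<^bsub>L\<^esub> = f_rest" .
  have ffj: "\<lbrakk>f r, \<lbrakk>f r, f j\<rbrakk>\<^bsub>L\<^esub>\<rbrakk>\<^bsub>L\<^esub> = \<zero>\<^bsub>L\<^esub>" if "j \<in> C - J" for j
    using that A_r[OF that] rC by (intro bracket_f_f_f) auto
  have "\<lbrakk>f r, \<lbrakk>f r, f_rest\<rbrakk>\<^bsub>L\<^esub>\<rbrakk>\<^bsub>L\<^esub> =
      (\<Oplus>\<^bsub>L\<^esub> j \<in> C - J. \<lbrakk>f r, \<lbrakk>f r, a j \<odot>\<^bsub>L\<^esub> f j\<rbrakk>\<^bsub>L\<^esub>\<rbrakk>\<^bsub>L\<^esub>)"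
    unfolding S_eq S_def by (simp add: bracket_finsum_right)
  also have "\<dots> = \<zero>\<^bsub>L\<^esub>"
    by (rule M.add.finprod_one_eqI) (simp add: bracket_smult_right ffj)
  finally have ff_rest: "\<lbrakk>f r, \<lbrakk>f r, f_rest\<rbrakk>\<^bsub>L\<^esub>\<rbrakk>\<^bsub>L\<^esub> = \<zero>\<^bsub>L\<^esub>" .
  have plus_e: "\<lbrakk>f_plus, e r\<rbrakk>\<^bsub>L\<^esub> = \<zero>\<^bsub>L\<^esub>"
    unfolding S_eq using JC(2) by (intro S_zero) (auto intro!: bracket_f_e)
  \<comment> \<open>Vertices in \<open>J\<close> are not adjacent to other children of
    \<open>r\<close>; hence the exponential of \<open>f_plus\<close> can serve as the
    \<open>\<psi>\<close> of \<open>Ad_exp_root\<close>.\<close>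
  have plus_rest: "\<lbrakk>f_plus, f_rest\<rbrakk>\<^bsub>L\<^esub> = \<zero>\<^bsub>L\<^esub>"
    unfolding S_eq
  proof (rule S_zero)
    fix j assume j: "j \<in> J"
    have "\<lbrakk>f k, f j\<rbrakk>\<^bsub>L\<^esub> = \<zero>\<^bsub>L\<^esub>" if "k \<in> C - J" for k
      using that j A_J0[of j k] rC by (intro bracket_f_f) auto
    then show "\<lbrakk>f j, S (C - J)\<rbrakk>\<^bsub>L\<^esub> = \<zero>\<^bsub>L\<^esub>" by (intro S_zero_right) auto
  qed simp
  have plus_fixed: "Ad_exp L f_plus (e r) = e r" "Ad_exp L f_plus f_rest = f_rest"
    using Ad_exp_fixed[OF _ _ plus_e] Ad_exp_fixed[OF _ _ plus_rest] by (simp_all add: S_eq)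
  note case_r = Ad_exp_root[OF nil_rest root h_rest ff_rest Ad_exp_automorphism[OF nil_plus]
      plus_fixed, of "a r", folded f'_r]

  \<comment> \<open>The remaining vertices\<close>
  have case_other: "Ad_prod L g (u i) =
       (if leaf G r i then e i
        else let i' = the_elem (children G r i) in e i \<oplus>\<^bsub>L\<^esub> (- a i' * a i) \<odot>\<^bsub>L\<^esub> f i')"
    if i: "i \<noteq> r" "i \<notin> J" for i
  proof -
    let ?m = "map (\<lambda>i. a i \<odot>\<^bsub>L\<^esub> f i)"
    obtain ys zs where yz: "xs = ys @ i # zs"
      using xs(2) i split_list[of i xs] by auto
    \<comment> \<open>The factors in \<open>zs\<close> act before that of \<open>i\<close>. The
      order keeps the parent of \<open>i\<close> out of \<open>zs\<close>, so only a child of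
      \<open>i\<close> can act nontrivially.\<close>
    have zs: "\<lbrakk>f k, u_elem (a i) i\<rbrakk>\<^bsub>L\<^esub> = \<zero>\<^bsub>L\<^esub>" if "k \<in> set zs" "\<not> parent_of G r i k" for k
    proof -
      have "k \<noteq> i" using that xs(1) yz by auto
      moreover have "\<not> parent_of G r k i"
        using xs_decreasing that(1) yz by (auto simp: sorted_wrt_append)
      ultimately show ?thesis
        using that adj[of i k] adj[of k i] by (intro bracket_f_u) auto
    qed
    show ?thesis
    proof (cases "leaf G r i")
      case True
      then have "\<not> parent_of G r i k" for k by (auto simp: leaf_def children_def)
      then have "Ad_prod L (?m zs) (u i) = u_elem (a i) i"
        using zs by (simp add: u' fixed_list)
      then have "Ad_prod L (?m xs) (u i) = Ad_prod L (?m ys) (e i)"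
        by (simp add: yz Ad_prod_def Ad_exp_f_u)
      also have "\<dots> = e i"
        using xs(1) yz by (intro fixed_list) (auto intro!: bracket_f_e)
      finally have "Ad_prod L g (u i) = Ad_exp L (S J) (Ad_exp L (a r \<odot>\<^bsub>L\<^esub> f r) (e i))"
        by (simp add: Ad_g)
      also have "Ad_exp L (a r \<odot>\<^bsub>L\<^esub> f r) (e i) = e i"
        using i by (intro Ad_exp_fixed) (auto simp: bracket_smult_left bracket_f_e)
      also have "Ad_exp L (S J) (e i) = e i"
        using i by (intro Ad_exp_fixed S_zero) (auto intro!: bracket_f_e)
      finally show ?thesis using True by simp
    next
      case False
      then obtain j where j: "parent_of G r i j" by (auto simp: leaf_def children_def)
      have ch: "children G r i = {j}"
        using only_child[OF i(1)] j by (auto simp: children_def)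
      have j': "j \<noteq> i" "j \<noteq> r" "j \<notin> J"
        using parent_neg(3)[OF j] j not_parent_of_root[of G r i] JC(1)[of j]
          parent_unique[OF j, of r] i(1)
        by auto
      \<comment> \<open>Both \<open>i\<close> and \<open>j\<close> differ from \<open>r\<close>, so
        \<open>A_outside\<close> applies in both directions; the edge rules out the value
        zero.\<close>
      have Aij: "A i j = -1" "A j i = -1"
        using A_outside[of i j] A_outside[of j i] j' i parent_neg[OF j] by auto
      have no_ij: "A j k = 0" "A k j = 0" if "k \<noteq> i" "k \<noteq> j" "\<not> parent_of G r j k" for k
        using adj[of j k] adj[of k j] that j parent_unique by metis+
      have "j \<in> set zs"
      proof -
        have "j \<in> set ys \<union> set zs" using xs(2) yz j' by auto
        moreover have "j \<notin> set ys"
          using xs_decreasing yz j by (auto simp: sorted_wrt_append)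
        ultimately show ?thesis by blast
      qed
      then obtain ps qs where pq: "zs = ps @ j # qs" by (meson split_list)
      have not_child: "\<not> parent_of G r j k" if "k \<in> set ys \<union> set ps" for k
        using xs_decreasing that by (auto simp: yz pq sorted_wrt_append)
      have dist: "k \<noteq> i" "k \<noteq> j" if "k \<in> set ys \<union> set ps \<union> set qs" for k
        using that xs(1) by (auto simp: yz pq)
      have "Ad_prod L (?m qs) (u i) = u_elem (a i) i"
        unfolding u'
      proof (rule fixed_list)
        fix k assume k: "k \<in> set qs"
        then have "\<not> parent_of G r i k" using only_child[OF i(1) j] dist by blast
        then show "\<lbrakk>f k, u_elem (a i) i\<rbrakk>\<^bsub>L\<^esub> = \<zero>\<^bsub>L\<^esub>" using zs k pq by auto
      qed simp
      then have "Ad_prod L (?m zs) (u i)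
          = Ad_prod L (?m ps) (Ad_exp L (a j \<odot>\<^bsub>L\<^esub> f j) (u_elem (a i) i))"
        by (simp add: pq Ad_prod_def)
      also have "\<dots> = Ad_exp L (a j \<odot>\<^bsub>L\<^esub> f j) (u_elem (a i) i)"
      proof (rule fixed_list)
        fix k assume k: "k \<in> set ps"
        then have "\<not> parent_of G r i k" using only_child[OF i(1) j] dist by blast
        then have ku: "\<lbrakk>f k, u_elem (a i) i\<rbrakk>\<^bsub>L\<^esub> = \<zero>\<^bsub>L\<^esub>" using zs k pq by auto
        have kj: "\<lbrakk>f k, f j\<rbrakk>\<^bsub>L\<^esub> = \<zero>\<^bsub>L\<^esub>"
          using no_ij[of k] k dist not_child by (intro bracket_f_f) auto
        note \<phi> = Ad_exp_automorphism[OF nilpotent_scaled_f[of "a j" j]]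
        \<comment> \<open>The automorphism of \<open>j\<close> fixes \<open>f k\<close>, so it
          carries \<open>[f k, u i] = 0\<close> to the desired bracket.\<close>
        have "Ad_exp L (a j \<odot>\<^bsub>L\<^esub> f j) (f k) = f k"
          using bracket_zero_swap[OF _ _ kj] by (intro Ad_exp_fixed) (auto simp: bracket_smult_left)
        then show "\<lbrakk>f k, Ad_exp L (a j \<odot>\<^bsub>L\<^esub> f j) (u_elem (a i) i)\<rbrakk>\<^bsub>L\<^esub> = \<zero>\<^bsub>L\<^esub>"
          using automorphism_bracket[OF \<phi>, of "f k" "u_elem (a i) i"] ku
          by (simp add: automorphism_zero[OF \<phi>])
      qed auto
      finally have "Ad_prod L (?m xs) (u i)
          = Ad_prod L (?m ys) (e i \<oplus>\<^bsub>L\<^esub> (- a j * a i) \<odot>\<^bsub>L\<^esub> f j)"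
        using Ad_exp_chain[OF j'(1)[symmetric] Aij, of "a i" "a j"] by (simp add: yz Ad_prod_def)
      \<comment> \<open>Apart from \<open>i\<close>, a neighbour of \<open>j\<close> is a child of
        \<open>j\<close>. Children of \<open>j\<close> come after \<open>j\<close> in
        \<open>xs\<close>, so their factors have acted before \<open>f j\<close> appears.\<close>
      moreover have final: "\<lbrakk>f k, e i \<oplus>\<^bsub>L\<^esub> (- a j * a i) \<odot>\<^bsub>L\<^esub> f j\<rbrakk>\<^bsub>L\<^esub> = \<zero>\<^bsub>L\<^esub>"
        if "k \<noteq> i" "k \<noteq> j" "\<not> parent_of G r j k" for k
        using no_ij[OF that] that
        by (simp add: bracket_add_right bracket_smult_right bracket_f_e bracket_f_f)
      ultimately have "Ad_prod L (?m xs) (u i) = e i \<oplus>\<^bsub>L\<^esub> (- a j * a i) \<odot>\<^bsub>L\<^esub> f j"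
        using dist not_child by (simp add: fixed_list)
      then have "Ad_prod L g (u i) = Ad_exp L (S J) (Ad_exp L (a r \<odot>\<^bsub>L\<^esub> f r)
          (e i \<oplus>\<^bsub>L\<^esub> (- a j * a i) \<odot>\<^bsub>L\<^esub> f j))"
        by (simp add: Ad_g)
      also have "Ad_exp L (a r \<odot>\<^bsub>L\<^esub> f r) (e i \<oplus>\<^bsub>L\<^esub> (- a j * a i) \<odot>\<^bsub>L\<^esub> f j)
          = e i \<oplus>\<^bsub>L\<^esub> (- a j * a i) \<odot>\<^bsub>L\<^esub> f j"
        using final[of r] i j' not_parent_of_root[of G r j]
        by (intro Ad_exp_fixed) (auto simp: bracket_smult_left)
      also have "Ad_exp L (S J) \<dots> = \<dots>"
      proof (intro Ad_exp_fixed S_zero final)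
        fix k assume k: "k \<in> J"
        then show "k \<noteq> i" "k \<noteq> j" using i j' by auto
        show "\<not> parent_of G r j k" using JC(1)[OF k] parent_unique j' by blast
      qed auto
      finally show ?thesis using False ch by simp
    qed
  qed

  have nil_g: "\<forall>x \<in> set g. locally_ad_nilpotent L x"
    using nil_plus by (auto simp: g nilpotent_scaled_f)
  have "Ad_prod L g (u r) = Ad_exp L f_plus (Ad_exp L (a r \<odot>\<^bsub>L\<^esub> f r) (Ad_exp L f_rest (u_elem (a r) r)))"
    by (simp add: Ad_g Ad_xs_r S_eq)
  then show ?thesis
    using nil_g case_J case_r case_other by simp
qed

end
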